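(* Consider the equation $\frac{d}{dt}f=\mathcal{T}(f)+\frac1\varepsilon\mathcal{Q}(f)$, where $\mathcal T,\mathcal Q$ satisfy the structural positivity assumptions (P1)-(P4) listed in the context, and the scheme with correction $$f^{(i)} = f^n + \Delta t\sum_{j=1}^{i-1}\tilde a_{ij}\mathcal T(f^{(j)}) + \Delta t\sum_{j=1}^i a_{ij}\tfrac1\varepsilon\mathcal Q(f^{(j)}),\quad i=1,\dots,\nu,$$ $$\tilde f^{n+1} = f^n + \Delta t\sum_{i=1}^\nu \tilde w_i\mathcal T(f^{(i)}) + \Delta t\sum_{i=1}^\nu w_i\tfrac1\varepsilon\mathcal Q(f^{(i)}),$$ $$f^{n+1}=\tilde f^{n+1}-\alpha\Delta t^2\tfrac1{\varepsilon^2}\mathcal Q'(f^* )\mathcal Q(f^{n+1}),$$ where $f^*$ is one of $f^n$, $f^{(i)}$ (some $i$), $\tilde f^{n+1}$, $f^{n+1}$. Suppose that the scheme is globally stiffly accurate, that it is either of type A and satisfies the type A positivity conditions, or of type ARS and satisfies the type ARS positivity conditions, that $\alpha\ge 0$, and that the order conditions $$\sum_{i=1}^\nu\tilde w_i=\sum_{i=1}^\nu w_i=1,\qquad \sum_{i=1}^\nu\tilde w_i\tilde c_i=\sum_{i=1}^\nu\tilde w_ic_i=\sum_{i=1}^\nu w_i\tilde c_i=\sum_{i=1}^\nu w_ic_i-\alpha=\frac12$$ hold. Then: (1) the scheme is second-order accurate in the regime $\varepsilon=O(1)$; (2) the scheme is positivity-preserving: if $f^n\ge 0$ and $\Delta t\le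 c_{\mathrm{sch}}\,\mathcal C$, then $f^{(i)}\ge 0$ for all $i=1,\dots,\nu$, $\tilde f^{n+1}\ge0$, and $f^{n+1}\ge 0$.
   Context: **Setting.** $f=f(t)$ takes values in a space of real-valued functions, $f\ge 0$ meaning pointwise nonnegativity; $\mathcal T,\mathcal Q$ are possibly nonlinear operators on it, $\varepsilon>0$, $\Delta t>0$. $\mathcal Q'(g)f=\lim_{\delta\to0}\frac{\mathcal Q(g+\delta f)-\mathcal Q(g)}{\delta}$ is the Fréchet derivative. The stage values and $f^{n+1}$ are understood to be solutions of the (implicit) relations of the scheme. **Structural positivity assumptions.** There is a constant $\mathcal C>0$ (the CFL constraint of the forward Euler step) such that: (P1) $f\ge0$ implies $f+a\Delta t\,\mathcal T(f)\ge0$ for every constant $a$ with $0\le a\Delta t\le\mathcal C$; (P2) if $g\ge0$, $b\ge 0$ is a constant and $f-b\mathcal Q(f)=g$, then $f\ge0$; (P3) if $g,h\ge0$, $b\ge0$ is a constant and $f+b\mathcal Q'(g)\mathcal Q(f)=h$, then $f\ge0$; (P4) if $h\ge0$, $b\ge0$ is a constant and $f+b\mathcal Q'(f)\mathcal Q(f)=h$, then $f\ge0$. **Coefficients.** $\tilde A=(\tilde a_{ij})$ and $A=(a_{ij})$ are real $\nu\times\nu$ matrices with $\tilde a_{ij}=0$ for $j\ge i$ and $a_{ij}=0$ for $j>i$; $\tilde w_i,w_i$ are real; $\tilde c_i=\sum_{j=1}^{i-1}\tilde a_{ij}$, $c_i=\sum_{j=1}^{i}a_{ij}$. - Globally stiffly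 accurate (GSA): $a_{\nu i}=w_i$ and $\tilde a_{\nu i}=\tilde w_i$ for all $i$ (so $\tilde f^{n+1}=f^{(\nu)}$). - Type A: $A$ is invertible. - Type ARS: the first row and first column of $A$ vanish, the submatrix $(a_{ij})_{i,j=2}^{\nu}$ is invertible, and $w_1=0$ (so $f^{(1)}=f^n$). **Type A positivity conditions.** Put, for $1\le j<i\le \nu$, recursively $$b_{ii}=\frac1{a_{ii}},\quad b_{ij}=-\frac1{a_{ii}}\sum_{l=j}^{i-1}a_{il}b_{lj},\quad \tilde b_{ij}=\frac1{a_{ii}}\Big(-\tilde a_{ij}-\sum_{l=j+1}^{i-1}a_{il}\tilde b_{lj}\Big),$$ $$c_{i0}=1-\sum_{j=1}^{i-1}\sum_{l=j}^{i-1}a_{il}b_{lj},\quad c_{ij}=\sum_{l=j}^{i-1}a_{il}b_{lj},\quad \tilde c_{ij}=\tilde a_{ij}+\sum_{l=j+1}^{i-1}a_{il}\tilde b_{lj}.$$ The conditions are: $a_{ii}>0$, $c_{i0}\ge0$ for $i=1,\dots,\nu$; $c_{ij}\ge0$, $\tilde c_{ij}\ge0$ for $i=2,\dots,\nu$, $j=1,\dots,i-1$. In this case $c_{\mathrm{sch}}=\min_{2\le i\le\nu,\,1\le j\le i-1}\{c_{ij}/\tilde c_{ij}\}$. **Type ARS positivity conditions.** With $b_{ij}$ ($2\le j\le i$) and $\tilde b_{ij}$ ($1\le j<i$, $i\ge 2$) given by the same formulas for $i=2,\dots,\nu$, put $$c_{i0}=1-\sum_{j=2}^{i-1}\sum_{l=j}^{i-1}a_{il}b_{lj},\quad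 \tilde c_{i0}=\tilde a_{i1}+\sum_{j=2}^{i-1}a_{ij}\tilde b_{j1},\quad c_{ij}=\sum_{l=j}^{i-1}a_{il}b_{lj},\quad \tilde c_{ij}=\tilde a_{ij}+\sum_{l=j+1}^{i-1}a_{il}\tilde b_{lj}.$$ The conditions are: $a_{ii}>0$, $c_{i0}\ge0$, $\tilde c_{i0}\ge0$ for $i=2,\dots,\nu$; $c_{ij}\ge0$, $\tilde c_{ij}\ge0$ for $i=3,\dots,\nu$, $j=2,\dots,i-1$. In this case $c_{\mathrm{sch}}=\min\big\{\min_{2\le i\le\nu}c_{i0}/\tilde c_{i0},\ \min_{3\le i\le\nu,\,2\le j\le i-1}c_{ij}/\tilde c_{ij}\big\}$. In both definitions of $c_{\mathrm{sch}}$ a ratio with zero denominator is read as $+\infty$. **Accuracy.** Second-order accurate in the regime $\varepsilon=O(1)$ means: with $\varepsilon$ fixed (say $\varepsilon=1$) and $f^n$ equal to the exact solution at $t^n$, one has $f^{n+1}=f_{\mathrm{exact}}(t^n+\Delta t)+O(\Delta t^3)$ as $\Delta t\to0$. Here $\mathcal T,\mathcal Q$ are taken smooth enough for the Taylor expansions involved, and $f^{(i)},f^{n+1},f^*=f^n+O(\Delta t)$. *)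

theory Defs
  imports
    "HOL-Analysis.Analysis"
    "HOL-Library.Landau_Symbols"
    "Jordan_Normal_Form.Matrix"
begin

section \<open>The function space and the operators\<close>

text \<open>
  A space of real-valued functions on the point set \<open>'x\<close>: the elements are represented by a
  normed space \<open>'a\<close> whose vectors are determined by their point values \<open>ev f x\<close>, with pointwise
  vector space operations.  The norm gives the limits and the \<open>O\<close>-terms; it need not be related
  to the point values.
\<close>

definition function_space :: "('a::real_normed_vector \<Rightarrow> 'x \<Rightarrow> real) \<Rightarrow> bool" where
  "function_space ev \<longleftrightarrow> inj ev \<and>
     (\<forall>f g x. ev (f + g) x = ev f x + ev g x) \<and> (\<forall>c f x. ev (c *\<^sub>R f) x = c * ev f x)"

definition nonneg :: "('a \<Rightarrow> 'x \<Rightarrow> real) \<Rightarrow> 'a \<Rightarrow> bool" where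
  "nonneg ev f \<longleftrightarrow> (\<forall>x. ev f x \<ge> 0)"

text \<open>\<open>op_deriv Q g f\<close> is $Q'(g)f$; it is meaningful only where the limit exists.\<close>

definition op_deriv ::
    "('a::real_normed_vector \<Rightarrow> 'a) \<Rightarrow> 'a \<Rightarrow> 'a \<Rightarrow> 'a" where
  "op_deriv Q g f = Lim (at 0) (\<lambda>\<delta>::real. (Q (g + \<delta> *\<^sub>R f) - Q g) /\<^sub>R \<delta>)"

definition op_differentiable :: "('a::real_normed_vector \<Rightarrow> 'a) \<Rightarrow> bool" where
  "op_differentiable Q \<longleftrightarrow>
     (\<forall>g f. \<exists>l. ((\<lambda>\<delta>::real. (Q (g + \<delta> *\<^sub>R f) - Q g) /\<^sub>R \<delta>) \<longlongrightarrow> l) (at 0))"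

text \<open>Twice continuously Frechet differentiable on the open set \<open>U\<close>.\<close>

definition C2_on :: "('a::real_normed_vector \<Rightarrow> 'a) \<Rightarrow> 'a set \<Rightarrow> bool" where
  "C2_on G U \<longleftrightarrow>
     (\<exists>(G' :: 'a \<Rightarrow> 'a \<Rightarrow>\<^sub>L 'a) (G'' :: 'a \<Rightarrow> 'a \<Rightarrow>\<^sub>L ('a \<Rightarrow>\<^sub>L 'a)).
        (\<forall>f\<in>U. (G has_derivative blinfun_apply (G' f)) (at f)) \<and>
        (\<forall>f\<in>U. (G' has_derivative blinfun_apply (G'' f)) (at f)) \<and>
        continuous_on U G'')"

definition P1 :: "('a::real_normed_vector \<Rightarrow> 'x \<Rightarrow> real) \<Rightarrow> ('a \<Rightarrow> 'a) \<Rightarrow> real \<Rightarrow> bool" where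
  "P1 ev T C \<longleftrightarrow>
     (\<forall>f a dt. nonneg ev f \<longrightarrow> dt > 0 \<longrightarrow> 0 \<le> a * dt \<longrightarrow> a * dt \<le> C \<longrightarrow>
        nonneg ev (f + (a * dt) *\<^sub>R T f))"

definition P2 :: "('a::real_normed_vector \<Rightarrow> 'x \<Rightarrow> real) \<Rightarrow> ('a \<Rightarrow> 'a) \<Rightarrow> bool" where
  "P2 ev Q \<longleftrightarrow>
     (\<forall>f g b. nonneg ev g \<longrightarrow> b \<ge> 0 \<longrightarrow> f - b *\<^sub>R Q f = g \<longrightarrow> nonneg ev f)"

definition P3 :: "('a::real_normed_vector \<Rightarrow> 'x \<Rightarrow> real) \<Rightarrow> ('a \<Rightarrow> 'a) \<Rightarrow> bool" where
  "P3 ev Q \<longleftrightarrow>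
     (\<forall>f g h b. nonneg ev g \<longrightarrow> nonneg ev h \<longrightarrow> b \<ge> 0 \<longrightarrow>
        f + b *\<^sub>R op_deriv Q g (Q f) = h \<longrightarrow> nonneg ev f)"

definition P4 :: "('a::real_normed_vector \<Rightarrow> 'x \<Rightarrow> real) \<Rightarrow> ('a \<Rightarrow> 'a) \<Rightarrow> bool" where
  "P4 ev Q \<longleftrightarrow>
     (\<forall>f h b. nonneg ev h \<longrightarrow> b \<ge> 0 \<longrightarrow>
        f + b *\<^sub>R op_deriv Q f (Q f) = h \<longrightarrow> nonneg ev f)"

section \<open>Coefficients\<close>

text \<open>
  Only the entries with indices in \<open>{1..stages}\<close> matter.  The components \<open>aE\<close>, \<open>wE\<close> (explicit part)
  are $\tilde a$, $\tilde w$; \<open>aI\<close>, \<open>wI\<close> (implicit part) are $a$, $w$.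
\<close>

record tableau =
  stages :: nat
  aE :: "nat \<Rightarrow> nat \<Rightarrow> real"
  aI :: "nat \<Rightarrow> nat \<Rightarrow> real"
  wE :: "nat \<Rightarrow> real"
  wI :: "nat \<Rightarrow> real"

definition imex_tableau :: "tableau \<Rightarrow> bool" where
  "imex_tableau s \<longleftrightarrow>
     (\<forall>i\<in>{1..stages s}. \<forall>j\<in>{1..stages s}.
        (j \<ge> i \<longrightarrow> aE s i j = 0) \<and> (j > i \<longrightarrow> aI s i j = 0))"

definition cE :: "tableau \<Rightarrow> nat \<Rightarrow> real" where
  "cE s i = (\<Sum>j\<in>{1..<i}. aE s i j)"

definition cI :: "tableau \<Rightarrow> nat \<Rightarrow> real" where
  "cI s i = (\<Sum>j\<in>{1..i}. aI s i j)"

definition GSA :: "tableau \<Rightarrow> bool" where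
  "GSA s \<longleftrightarrow>
     (\<forall>i\<in>{1..stages s}. aI s (stages s) i = wI s i \<and> aE s (stages s) i = wE s i)"

text \<open>Matrices of type \<open>mat\<close> are indexed from 0, hence the shifts below.\<close>

definition type_A :: "tableau \<Rightarrow> bool" where
  "type_A s \<longleftrightarrow>
     invertible_mat (mat (stages s) (stages s) (\<lambda>(i, j). aI s (i + 1) (j + 1)))"

definition type_ARS :: "tableau \<Rightarrow> bool" where
  "type_ARS s \<longleftrightarrow>
     (\<forall>i\<in>{1..stages s}. aI s 1 i = 0 \<and> aI s i 1 = 0) \<and>
     invertible_mat (mat (stages s - 1) (stages s - 1) (\<lambda>(i, j). aI s (i + 2) (j + 2))) \<and>
     wI s 1 = 0"

definition order_conditions :: "tableau \<Rightarrow> real \<Rightarrow> bool" where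
  "order_conditions s \<alpha> \<longleftrightarrow>
     (\<Sum>i\<in>{1..stages s}. wE s i) = 1 \<and>
     (\<Sum>i\<in>{1..stages s}. wI s i) = 1 \<and>
     (\<Sum>i\<in>{1..stages s}. wE s i * cE s i) = 1/2 \<and>
     (\<Sum>i\<in>{1..stages s}. wE s i * cI s i) = 1/2 \<and>
     (\<Sum>i\<in>{1..stages s}. wI s i * cE s i) = 1/2 \<and>
     (\<Sum>i\<in>{1..stages s}. wI s i * cI s i) - \<alpha> = 1/2"

section \<open>Positivity conditions on the coefficients\<close>

text \<open>
  \<open>bI\<close>, \<open>bE\<close> are $b_{ij}$ ($j \le i$) and $\tilde b_{ij}$ ($j < i$); \<open>dI\<close>, \<open>dE\<close> are $c_{ij}$ and
  $\tilde c_{ij}$.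
\<close>

fun bI :: "tableau \<Rightarrow> nat \<Rightarrow> nat \<Rightarrow> real" where
  "bI s i j =
     (if j = i then 1 / aI s i i
      else - (1 / aI s i i) * (\<Sum>l\<in>{j..<i}. aI s i l * bI s l j))"

fun bE :: "tableau \<Rightarrow> nat \<Rightarrow> nat \<Rightarrow> real" where
  "bE s i j =
     (1 / aI s i i) * (- aE s i j - (\<Sum>l\<in>{j+1..<i}. aI s i l * bE s l j))"

declare bI.simps [simp del] bE.simps [simp del]

definition dI :: "tableau \<Rightarrow> nat \<Rightarrow> nat \<Rightarrow> real" where
  "dI s i j = (\<Sum>l\<in>{j..<i}. aI s i l * bI s l j)"

definition dE :: "tableau \<Rightarrow> nat \<Rightarrow> nat \<Rightarrow> real" where
  "dE s i j = aE s i j + (\<Sum>l\<in>{j+1..<i}. aI s i l * bE s l j)"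

definition dI0_A :: "tableau \<Rightarrow> nat \<Rightarrow> real" where
  "dI0_A s i = 1 - (\<Sum>j\<in>{1..<i}. \<Sum>l\<in>{j..<i}. aI s i l * bI s l j)"

definition dI0_ARS :: "tableau \<Rightarrow> nat \<Rightarrow> real" where
  "dI0_ARS s i = 1 - (\<Sum>j\<in>{2..<i}. \<Sum>l\<in>{j..<i}. aI s i l * bI s l j)"

definition dE0_ARS :: "tableau \<Rightarrow> nat \<Rightarrow> real" where
  "dE0_ARS s i = aE s i 1 + (\<Sum>j\<in>{2..<i}. aI s i j * bE s j 1)"

definition positivity_A :: "tableau \<Rightarrow> bool" where
  "positivity_A s \<longleftrightarrow>
     (\<forall>i\<in>{1..stages s}. aI s i i > 0 \<and> dI0_A s i \<ge> 0) \<and>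
     (\<forall>i\<in>{2..stages s}. \<forall>j\<in>{1..<i}. dI s i j \<ge> 0 \<and> dE s i j \<ge> 0)"

definition positivity_ARS :: "tableau \<Rightarrow> bool" where
  "positivity_ARS s \<longleftrightarrow>
     (\<forall>i\<in>{2..stages s}. aI s i i > 0 \<and> dI0_ARS s i \<ge> 0 \<and> dE0_ARS s i \<ge> 0) \<and>
     (\<forall>i\<in>{3..stages s}. \<forall>j\<in>{2..<i}. dI s i j \<ge> 0 \<and> dE s i j \<ge> 0)"

definition ratio :: "real \<Rightarrow> real \<Rightarrow> ereal" where
  "ratio p q = (if q = 0 then \<infinity> else ereal (p / q))"

text \<open>The infima are over finite sets, so they are minima (\<open>\<infinity>\<close> over an empty index set).\<close>

definition c_sch_A :: "tableau \<Rightarrow> ereal" where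
  "c_sch_A s = (INF i\<in>{2..stages s}. INF j\<in>{1..<i}. ratio (dI s i j) (dE s i j))"

definition c_sch_ARS :: "tableau \<Rightarrow> ereal" where
  "c_sch_ARS s =
     min (INF i\<in>{2..stages s}. ratio (dI0_ARS s i) (dE0_ARS s i))
         (INF i\<in>{3..stages s}. INF j\<in>{2..<i}. ratio (dI s i j) (dE s i j))"

text \<open>A tableau with at least one stage is not both of type A and of type ARS.\<close>

definition c_sch :: "tableau \<Rightarrow> ereal" where
  "c_sch s = (if type_A s then c_sch_A s else c_sch_ARS s)"

section \<open>The scheme with correction\<close>

text \<open>
  One step of size \<open>dt\<close> from \<open>fn\<close>, as a relation since the scheme is implicit: stage values \<open>F i\<close>,
  uncorrected value \<open>ft\<close> ($\tilde f^{n+1}$), linearization point \<open>fs\<close> ($f^*$), new value \<open>fnew\<close>.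
\<close>

definition scheme_step ::
    "('a::real_normed_vector \<Rightarrow> 'a) \<Rightarrow> ('a \<Rightarrow> 'a) \<Rightarrow> real \<Rightarrow> tableau \<Rightarrow> real \<Rightarrow> real \<Rightarrow>
     'a \<Rightarrow> (nat \<Rightarrow> 'a) \<Rightarrow> 'a \<Rightarrow> 'a \<Rightarrow> 'a \<Rightarrow> bool" where
  "scheme_step T Q \<epsilon> s \<alpha> dt fn F ft fs fnew \<longleftrightarrow>
     (\<forall>i\<in>{1..stages s}.
        F i = fn + dt *\<^sub>R (\<Sum>j\<in>{1..<i}. aE s i j *\<^sub>R T (F j))
                 + dt *\<^sub>R (\<Sum>j\<in>{1..i}. aI s i j *\<^sub>R ((1/\<epsilon>) *\<^sub>R Q (F j)))) \<and>
     ft = fn + dt *\<^sub>R (\<Sum>i\<in>{1..stages s}. wE s i *\<^sub>R T (F i))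
             + dt *\<^sub>R (\<Sum>i\<in>{1..stages s}. wI s i *\<^sub>R ((1/\<epsilon>) *\<^sub>R Q (F i))) \<and>
     fnew = ft - (\<alpha> * dt^2 * (1/\<epsilon>^2)) *\<^sub>R op_deriv Q fs (Q fnew) \<and>
     fs \<in> {fn, ft, fnew} \<union> F ` {1..stages s}"

text \<open>
  The exact solution \<open>u\<close> is only needed on some interval to the right of \<open>tn\<close>, and the smoothness
  of the operators only near \<open>u tn\<close>.
\<close>

definition second_order_accurate ::
    "('a::real_normed_vector \<Rightarrow> 'a) \<Rightarrow> ('a \<Rightarrow> 'a) \<Rightarrow> real \<Rightarrow> tableau \<Rightarrow> real \<Rightarrow> bool" where
  "second_order_accurate T Q \<epsilon> s \<alpha> \<longleftrightarrow>
     (\<forall>(u :: real \<Rightarrow> 'a) tn \<tau> U F ft fs fnew.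
        open U \<longrightarrow> u tn \<in> U \<longrightarrow> C2_on T U \<longrightarrow> C2_on Q U \<longrightarrow>
        \<tau> > 0 \<longrightarrow>
        (\<forall>t\<in>{tn..tn+\<tau>}.
           (u has_vector_derivative T (u t) + (1/\<epsilon>) *\<^sub>R Q (u t)) (at t within {tn..tn+\<tau>})) \<longrightarrow>
        (\<forall>\<^sub>F dt in at_right 0.
           scheme_step T Q \<epsilon> s \<alpha> dt (u tn) (F dt) (ft dt) (fs dt) (fnew dt)) \<longrightarrow>
        (\<forall>i\<in>{1..stages s}. (\<lambda>dt. norm (F dt i - u tn)) \<in> O[at_right 0](\<lambda>dt. dt)) \<longrightarrow>
        (\<lambda>dt. norm (fs dt - u tn)) \<in> O[at_right 0](\<lambda>dt. dt) \<longrightarrow>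
        (\<lambda>dt. norm (fnew dt - u tn)) \<in> O[at_right 0](\<lambda>dt. dt) \<longrightarrow>
        (\<lambda>dt. norm (fnew dt - u (tn + dt))) \<in> O[at_right 0](\<lambda>dt. dt^3))"

definition positivity_preserving ::
    "('a::real_normed_vector \<Rightarrow> 'x \<Rightarrow> real) \<Rightarrow> ('a \<Rightarrow> 'a) \<Rightarrow> ('a \<Rightarrow> 'a) \<Rightarrow> real \<Rightarrow> real \<Rightarrow>
     tableau \<Rightarrow> real \<Rightarrow> bool" where
  "positivity_preserving ev T Q C \<epsilon> s \<alpha> \<longleftrightarrow>
     (\<forall>dt fn F ft fs fnew.
        dt > 0 \<longrightarrow> scheme_step T Q \<epsilon> s \<alpha> dt fn F ft fs fnew \<longrightarrow>
        nonneg ev fn \<longrightarrow> ereal dt \<le> c_sch s * ereal C \<longrightarrow>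
        (\<forall>i\<in>{1..stages s}. nonneg ev (F i)) \<and> nonneg ev ft \<and> nonneg ev fnew)"

end

theory Submission
  imports Defs
begin

text \<open>
  \<^bold>\<open>Why positivity holds.\<close>  The stage equations are a lower triangular linear system for the implicit
  terms $(\Delta t/\varepsilon) Q(f^{(j)})$.  Solving it (\<open>implicit_term_eq\<close>) and substituting the
  solution for the implicit terms of the earlier stages gives
  $$f^{(i)} - a_{ii} \frac{\Delta t}{\varepsilon} Q(f^{(i)}) = c_{i0} f^n +
    \sum_{j<i} \big(c_{ij} f^{(j)} + \tilde c_{ij} \Delta t\, T(f^{(j)})\big)$$
  (\<open>stage_without_implicit_history\<close>; for type ARS the first stage is $f^n$ and its explicit term
  joins $f^n$).  The positivity conditions make this a convex combination of $f^n$ and of forward Euler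
  steps of sizes $\Delta t\, \tilde c_{ij}/c_{ij} \le C$, so that the right-hand side is nonnegative by
  \<open>P1\<close>; the implicit solve preserves the sign by \<open>P2\<close>.  Induction over the stages gives
  \<open>stages_nonneg_type_A\<close> and \<open>stages_nonneg_type_ARS\<close>.  By global stiff accuracy the uncorrected value
  is the last stage, and the correction is a further implicit solve to which \<open>P3\<close> or \<open>P4\<close> applies.

  \<^bold>\<open>Why the scheme is accurate.\<close>  With $G = T + Q/\varepsilon$, the exact solution satisfies
  $u(t+d) = u_0 + d\, G(u_0) + \frac{d^2}{2} G'(u_0) G(u_0) + O(d^3)$ (\<open>exact_solution_expansion\<close>).
  The uncorrected value has an expansion of the same form whose coefficients are the sums in the order
  conditions.  The implicit weights leave an excess $\alpha\, d^2 \varepsilon^{-2} Q'(u_0) Q(u_0)$,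
  and the correction removes it up to $O(d^3)$
  (\<open>second_order_accurate_if_order_conditions\<close>).  Only the values and first derivatives at $u_0$
  enter, with remainders bounded near $u_0$ (\<open>C2_on_expansion\<close>).
\<close>

section \<open>Elimination of the implicit terms\<close>

lemma bI_diag: "bI s i i = 1 / aI s i i"
  by (subst bI.simps) simp

text \<open>The recursions for $b_{ij}$ and $\tilde b_{ij}$ contain the coefficients $c_{ij}$ and
  $\tilde c_{ij}$ themselves.\<close>

lemma bI_off_diag: "j < i \<Longrightarrow> bI s i j = - (1 / aI s i i) * dI s i j"
  by (subst bI.simps) (simp add: dI_def)

lemma bE_eq: "bE s i j = - (1 / aI s i i) * dE s i j"
  by (subst bE.simps) (simp add: dE_def algebra_simps)

text \<open>Exchanging the summations in the two triangular double sums is what makes the coefficients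
  \<open>dI\<close> and \<open>dE\<close> appear.\<close>

lemma sum_lower_triangle_swap:
  fixes g :: "nat \<Rightarrow> nat \<Rightarrow> 'b::comm_monoid_add"
  shows "(\<Sum>l\<in>{m..<i}. \<Sum>j\<in>{m..l}. g l j) = (\<Sum>j\<in>{m..<i}. \<Sum>l\<in>{j..<i}. g l j)"
  by (subst (1 2) sum.Sigma; simp?)
     (rule sum.reindex_bij_witness[of _ prod.swap prod.swap]; auto)

lemma sum_strict_lower_triangle_swap:
  fixes g :: "nat \<Rightarrow> nat \<Rightarrow> 'b::comm_monoid_add"
  assumes "m \<le> 2"
  shows "(\<Sum>l\<in>{m..<i}. \<Sum>j\<in>{1..<l}. g l j) = (\<Sum>j\<in>{1..<i}. \<Sum>l\<in>{j+1..<i}. g l j)"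
  using assms
  by (subst (1 2) sum.Sigma; simp?)
     (rule sum.reindex_bij_witness[of _ prod.swap prod.swap]; auto)

text \<open>Here and in the next two lemmas, \<open>q j\<close> stands for the implicit term $(\Delta t/\varepsilon) Q(f^{(j)})$
  and \<open>D j\<close> for the explicit term $\Delta t\, T(f^{(j)})$.  The implicit terms start at the index
  \<open>m\<close>, which is 1 for type A and 2 for type ARS; the explicit ones always start at 1.  With
  \<open>m \<le> 2\<close> every \<open>l > j \<ge> 1\<close> satisfies \<open>l \<ge> m\<close>, so that no term of the
  recursion for $\tilde b_{ij}$ is lost.\<close>

lemma earlier_implicit_terms:
  fixes F D q :: "nat \<Rightarrow> 'a::real_vector"
  assumes "m \<le> 2"
    and q: "\<And>l. l \<in> {m..<i} \<Longrightarrow>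
      q l = (\<Sum>j\<in>{m..l}. bI s l j *\<^sub>R (F j - fn)) + (\<Sum>j\<in>{1..<l}. bE s l j *\<^sub>R D j)"
  shows "(\<Sum>j\<in>{1..<i}. aE s i j *\<^sub>R D j) + (\<Sum>l\<in>{m..<i}. aI s i l *\<^sub>R q l)
    = (\<Sum>j\<in>{m..<i}. dI s i j *\<^sub>R (F j - fn)) + (\<Sum>j\<in>{1..<i}. dE s i j *\<^sub>R D j)"
proof -
  have "(\<Sum>l\<in>{m..<i}. aI s i l *\<^sub>R q l)
      = (\<Sum>l\<in>{m..<i}. \<Sum>j\<in>{m..l}. (aI s i l * bI s l j) *\<^sub>R (F j - fn))
        + (\<Sum>l\<in>{m..<i}. \<Sum>j\<in>{1..<l}. (aI s i l * bE s l j) *\<^sub>R D j)"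
    by (simp add: q scaleR_add_right scaleR_sum_right sum.distrib)
  also have "\<dots> = (\<Sum>j\<in>{m..<i}. dI s i j *\<^sub>R (F j - fn))
        + (\<Sum>j\<in>{1..<i}. (\<Sum>l\<in>{j+1..<i}. aI s i l * bE s l j) *\<^sub>R D j)"
    unfolding sum_lower_triangle_swap sum_strict_lower_triangle_swap[OF assms(1)]
    by (simp add: dI_def scaleR_sum_left)
  finally show ?thesis
    by (simp add: dE_def scaleR_add_left sum.distrib)
qed

text \<open>Solving the triangular system of the stages for the implicit terms, which is possible because the
  diagonal does not vanish: $b_{ij}$ and $\tilde b_{ij}$ are the coefficients of the solution.\<close>

lemma implicit_term_eq:
  fixes F D q :: "nat \<Rightarrow> 'a::real_vector"
  assumes "m \<le> 2"
    and stage: "\<And>i. i \<in> {m..n} \<Longrightarrow> F i = fn + (\<Sum>j\<in>{1..<i}. aE s i j *\<^sub>R D j)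
        + (\<Sum>j\<in>{m..i}. aI s i j *\<^sub>R q j)"
    and diag: "\<And>i. i \<in> {m..n} \<Longrightarrow> aI s i i \<noteq> 0"
    and "i \<in> {m..n}"
  shows "q i = (\<Sum>j\<in>{m..i}. bI s i j *\<^sub>R (F j - fn)) + (\<Sum>j\<in>{1..<i}. bE s i j *\<^sub>R D j)"
  using assms(4)
proof (induction i rule: less_induct)
  case (less i)
  have split: "{m..i} = insert i {m..<i}" using less.prems by auto
  let ?a = "aI s i i"
  have "F i - fn = ((\<Sum>j\<in>{1..<i}. aE s i j *\<^sub>R D j) + (\<Sum>l\<in>{m..<i}. aI s i l *\<^sub>R q l)) + ?a *\<^sub>R q i"
    using stage[OF less.prems] by (simp add: split algebra_simps)
  also have "(\<Sum>j\<in>{1..<i}. aE s i j *\<^sub>R D j) + (\<Sum>l\<in>{m..<i}. aI s i l *\<^sub>R q l)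
      = (\<Sum>j\<in>{m..<i}. dI s i j *\<^sub>R (F j - fn)) + (\<Sum>j\<in>{1..<i}. dE s i j *\<^sub>R D j)"
    by (rule earlier_implicit_terms[OF assms(1)]) (use less in auto)
  finally have aq: "?a *\<^sub>R q i = (F i - fn) - (\<Sum>j\<in>{m..<i}. dI s i j *\<^sub>R (F j - fn))
      - (\<Sum>j\<in>{1..<i}. dE s i j *\<^sub>R D j)" by (simp add: algebra_simps)
  have "q i = (1 / ?a) *\<^sub>R (?a *\<^sub>R q i)"
    using diag[OF less.prems] by simp
  also have "\<dots> = (\<Sum>j\<in>{m..i}. bI s i j *\<^sub>R (F j - fn)) + (\<Sum>j\<in>{1..<i}. bE s i j *\<^sub>R D j)"
    unfolding aq by (simp add: split bI_diag bI_off_diag bE_eq scaleR_diff_right[of "1 / ?a"] scaleR_sum_right sum_negf)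
  finally show ?case .
qed

text \<open>After the elimination, a stage depends on the earlier ones only through their values and their
  explicit terms.  The coefficients of \<open>fn\<close> and of the values sum to 1, so with nonnegative
  coefficients the right-hand side is a convex combination of \<open>fn\<close> and of forward Euler steps.\<close>

lemma stage_without_implicit_history:
  fixes F D q :: "nat \<Rightarrow> 'a::real_vector"
  assumes "m \<le> 2"
    and stage: "\<And>i. i \<in> {m..n} \<Longrightarrow> F i = fn + (\<Sum>j\<in>{1..<i}. aE s i j *\<^sub>R D j)
        + (\<Sum>j\<in>{m..i}. aI s i j *\<^sub>R q j)"
    and diag: "\<And>i. i \<in> {m..n} \<Longrightarrow> aI s i i \<noteq> 0"
    and i: "i \<in> {m..n}"
  shows "F i - aI s i i *\<^sub>R q i = (1 - (\<Sum>j\<in>{m..<i}. dI s i j)) *\<^sub>R fn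
    + (\<Sum>j\<in>{m..<i}. dI s i j *\<^sub>R F j) + (\<Sum>j\<in>{1..<i}. dE s i j *\<^sub>R D j)"
proof -
  have split: "{m..i} = insert i {m..<i}" using i by auto
  have "F i - aI s i i *\<^sub>R q i = fn + ((\<Sum>j\<in>{1..<i}. aE s i j *\<^sub>R D j)
      + (\<Sum>l\<in>{m..<i}. aI s i l *\<^sub>R q l))"
    using stage[OF i] by (simp add: split algebra_simps)
  also have "(\<Sum>j\<in>{1..<i}. aE s i j *\<^sub>R D j) + (\<Sum>l\<in>{m..<i}. aI s i l *\<^sub>R q l)
      = (\<Sum>j\<in>{m..<i}. dI s i j *\<^sub>R (F j - fn)) + (\<Sum>j\<in>{1..<i}. dE s i j *\<^sub>R D j)"
    by (rule earlier_implicit_terms[OF assms(1)], rule implicit_term_eq[OF assms(1-3)])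
       (use i in auto)
  finally show ?thesis
    by (simp add: scaleR_diff_right scaleR_diff_left sum_subtractf scaleR_sum_left)
qed

section \<open>Positivity of one step\<close>

lemma ev_zero: "function_space ev \<Longrightarrow> ev 0 x = 0"
  unfolding function_space_def by (metis mult_zero_left scaleR_zero_left)

lemma nonneg_add: "function_space ev \<Longrightarrow> nonneg ev f \<Longrightarrow> nonneg ev g \<Longrightarrow> nonneg ev (f + g)"
  by (simp add: nonneg_def function_space_def)

lemma nonneg_scaleR: "function_space ev \<Longrightarrow> r \<ge> 0 \<Longrightarrow> nonneg ev f \<Longrightarrow> nonneg ev (r *\<^sub>R f)"
  by (simp add: nonneg_def function_space_def)

lemma nonneg_sum:
  assumes "function_space ev"
  shows "(\<And>i. i \<in> I \<Longrightarrow> nonneg ev (f i)) \<Longrightarrow> nonneg ev (\<Sum>i\<in>I. f i)"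
proof (induction I rule: infinite_finite_induct)
  case (insert i I)
  then show ?case by (simp add: nonneg_add[OF assms])
qed (simp_all add: nonneg_def ev_zero[OF assms])

text \<open>A forward Euler step of size $\Delta t\, q/p$, scaled by \<open>p\<close>.  For \<open>p = 0 < q\<close> the ratio is 0, and
  the time step restriction excludes this case.\<close>

lemma nonneg_Euler_combination:
  assumes fs: "function_space ev" and P1: "P1 ev T C" and "C > 0"
    and "dt > 0" and "p \<ge> 0" and "q \<ge> 0" and dt: "ereal dt \<le> ratio p q * ereal C"
    and f: "nonneg ev f"
  shows "nonneg ev (p *\<^sub>R f + q *\<^sub>R (dt *\<^sub>R T f))"
proof (cases "q = 0")
  case True
  then show ?thesis using nonneg_scaleR[OF fs \<open>p \<ge> 0\<close> f] by simp
next
  case False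
  then have q: "q > 0" using \<open>q \<ge> 0\<close> by simp
  have le: "dt * q \<le> p * C"
    using dt q by (simp add: ratio_def field_simps)
  moreover have "dt * q > 0" using q \<open>dt > 0\<close> by simp
  ultimately have p: "p > 0" using \<open>p \<ge> 0\<close> by (cases "p = 0") auto
  have "nonneg ev (f + ((q / p) * dt) *\<^sub>R T f)"
    using \<open>dt > 0\<close> p q le
    by (intro P1[unfolded P1_def, rule_format, OF f \<open>dt > 0\<close>]) (auto simp: field_simps)
  then have "nonneg ev (p *\<^sub>R (f + ((q / p) * dt) *\<^sub>R T f))"
    using nonneg_scaleR[OF fs \<open>p \<ge> 0\<close>] by blast
  then show ?thesis using p by (simp add: scaleR_add_right)
qed

text \<open>The definition of \<open>c_sch\<close> decides by \<open>type_A\<close>, so for type ARS it has to be excluded: a matrix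
  with a zero first row has no right inverse.\<close>

lemma not_type_A_if_type_ARS:
  assumes "type_ARS s" and "stages s \<ge> 1"
  shows "\<not> type_A s"
proof
  assume "type_A s"
  define M where "M = mat (stages s) (stages s) (\<lambda>(i, j). aI s (i + 1) (j + 1))"
  obtain B where B: "M * B = 1\<^sub>m (stages s)" and BM: "B * M = 1\<^sub>m (dim_row B)"
    using \<open>type_A s\<close> unfolding type_A_def M_def invertible_mat_def inverts_mat_def by auto
  have dims: "dim_col B = stages s" "dim_row B = stages s"
    using arg_cong[OF B, of dim_col] arg_cong[OF BM, of dim_col] by (simp_all add: M_def)
  have "row M 0 = 0\<^sub>v (stages s)"
    using assms by (intro eq_vecI) (auto simp: M_def type_ARS_def)
  have "1 = (M * B) $$ (0, 0)" using assms(2) by (simp add: B)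
  also have "\<dots> = row M 0 \<bullet> col B 0"
    using assms(2) dims by (simp add: M_def)
  also have "\<dots> = 0"
    using dims by (simp add: \<open>row M 0 = _\<close> scalar_prod_def)
  finally show False by simp
qed

lemma scheme_step_stage:
  assumes "scheme_step T Q \<epsilon> s \<alpha> dt fn F ft fs fnew" and "i \<in> {1..stages s}"
  shows "F i = fn + (\<Sum>j\<in>{1..<i}. aE s i j *\<^sub>R (dt *\<^sub>R T (F j)))
      + (\<Sum>j\<in>{1..i}. aI s i j *\<^sub>R ((dt / \<epsilon>) *\<^sub>R Q (F j)))"
proof -
  have "F i = fn + dt *\<^sub>R (\<Sum>j\<in>{1..<i}. aE s i j *\<^sub>R T (F j))
                 + dt *\<^sub>R (\<Sum>j\<in>{1..i}. aI s i j *\<^sub>R ((1/\<epsilon>) *\<^sub>R Q (F j)))"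
    using assms unfolding scheme_step_def by blast
  then show ?thesis by (simp add: scaleR_sum_right mult_ac)
qed

text \<open>With the history eliminated, the only remaining implicit term of a stage is its own, and this is
  a backward Euler step as in \<open>P2\<close>.\<close>

lemma nonneg_implicit_solve:
  assumes "P2 ev Q" and "a > 0" and "\<epsilon> > 0" and "dt > 0"
    and "nonneg ev (f - a *\<^sub>R ((dt / \<epsilon>) *\<^sub>R Q f))"
  shows "nonneg ev f"
proof -
  have "a * (dt / \<epsilon>) \<ge> 0" using assms by simp
  with assms(1,5) show ?thesis unfolding P2_def by (metis scaleR_scaleR)
qed

lemma stages_nonneg_type_A:
  assumes fs: "function_space ev" and P1: "P1 ev T C" and P2: "P2 ev Q"
    and "C > 0" and "\<epsilon> > 0" and "dt > 0"
    and step: "scheme_step T Q \<epsilon> s \<alpha> dt fn F ft fs fnew"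
    and pos: "positivity_A s" and fn: "nonneg ev fn"
    and dt: "ereal dt \<le> c_sch_A s * ereal C"
    and "i \<in> {1..stages s}"
  shows "nonneg ev (F i)"
  using assms(11)
proof (induction i rule: less_induct)
  case (less i)
  have a: "aI s j j > 0" if "j \<in> {1..stages s}" for j
    using pos that by (simp add: positivity_A_def)
  then have nz: "aI s j j \<noteq> 0" if "j \<in> {1..stages s}" for j
    using that by fastforce
  have eq: "F i - aI s i i *\<^sub>R ((dt / \<epsilon>) *\<^sub>R Q (F i)) = dI0_A s i *\<^sub>R fn
      + (\<Sum>j\<in>{1..<i}. dI s i j *\<^sub>R F j + dE s i j *\<^sub>R (dt *\<^sub>R T (F j)))"
    by (subst stage_without_implicit_history[where m = 1 and n = "stages s"
          and D = "\<lambda>j. dt *\<^sub>R T (F j)" and q = "\<lambda>j. (dt / \<epsilon>) *\<^sub>R Q (F j)",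
          OF _ scheme_step_stage[OF step]])
       (use nz less.prems in \<open>auto simp: dI0_A_def dI_def sum.distrib \<close>)
  have "nonneg ev (dI s i j *\<^sub>R F j + dE s i j *\<^sub>R (dt *\<^sub>R T (F j)))" if j: "j \<in> {1..<i}" for j
  proof (rule nonneg_Euler_combination[OF fs P1 \<open>C > 0\<close> \<open>dt > 0\<close>])
    have i: "i \<in> {2..stages s}" using less.prems j by auto
    then show "dI s i j \<ge> 0" "dE s i j \<ge> 0" using pos j by (auto simp: positivity_A_def)
    have "c_sch_A s \<le> ratio (dI s i j) (dE s i j)"
      unfolding c_sch_A_def by (rule INF_lower2[OF i], rule INF_lower[OF j])
    then show "ereal dt \<le> ratio (dI s i j) (dE s i j) * ereal C"
      using dt \<open>C > 0\<close> by (meson ereal_mult_right_mono ereal_less_eq(5) less_imp_le order_trans)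
    show "nonneg ev (F j)" using less j by auto
  qed
  moreover have "nonneg ev (dI0_A s i *\<^sub>R fn)"
    using pos less.prems by (intro nonneg_scaleR[OF fs _ fn]) (simp add: positivity_A_def)
  ultimately have "nonneg ev (F i - aI s i i *\<^sub>R ((dt / \<epsilon>) *\<^sub>R Q (F i)))"
    unfolding eq by (blast intro: nonneg_add[OF fs] nonneg_sum[OF fs])
  then show ?case
    using nonneg_implicit_solve[OF P2 a[OF less.prems] \<open>\<epsilon> > 0\<close> \<open>dt > 0\<close>] by blast
qed

text \<open>The first stage is \<open>fn\<close>, so its value contributes to the coefficient of \<open>fn\<close> and its explicit
  term is paired with \<open>fn\<close> in one more Euler step; this is the extra ratio in \<open>c_sch_ARS\<close>.\<close>

lemma stages_nonneg_type_ARS: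
  assumes fs: "function_space ev" and P1: "P1 ev T C" and P2: "P2 ev Q"
    and "C > 0" and "\<epsilon> > 0" and "dt > 0"
    and step: "scheme_step T Q \<epsilon> s \<alpha> dt fn F ft fs fnew"
    and ARS: "type_ARS s" and pos: "positivity_ARS s" and fn: "nonneg ev fn"
    and dt: "ereal dt \<le> c_sch_ARS s * ereal C"
    and "i \<in> {1..stages s}"
  shows "nonneg ev (F i)"
  using assms(12)
proof (induction i rule: less_induct)
  case (less i)
  have F1: "F 1 = fn"
    using scheme_step_stage[OF step, of 1] less.prems ARS by (simp add: type_ARS_def)
  show ?case
  proof (cases "i = 1")
    case True
    then show ?thesis using F1 fn by simp
  next
    case False
    then have i: "i \<in> {2..stages s}" using less.prems by auto
    have a: "aI s j j > 0" if "j \<in> {2..stages s}" for j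
      using pos that by (simp add: positivity_ARS_def)
    then have nz: "aI s j j \<noteq> 0" if "j \<in> {2..stages s}" for j
      using that by fastforce
    have stage: "F j = fn + (\<Sum>k\<in>{1..<j}. aE s j k *\<^sub>R (dt *\<^sub>R T (F k)))
        + (\<Sum>k\<in>{2..j}. aI s j k *\<^sub>R ((dt / \<epsilon>) *\<^sub>R Q (F k)))" if j: "j \<in> {2..stages s}" for j
    proof -
      have "{1..j} = insert 1 {2..j}" using j by auto
      moreover have "aI s j 1 = 0" using ARS j by (simp add: type_ARS_def)
      ultimately show ?thesis using scheme_step_stage[OF step, of j] j by simp
    qed
    \<comment> \<open>the explicit term of the first stage is split off, to be paired with \<open>fn\<close>\<close>
    have "{1..<i} = insert 1 {2..<i}" using i by auto
    moreover have "dE s i 1 = dE0_ARS s i" by (simp add: dE_def dE0_ARS_def numeral_2_eq_2)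
    ultimately have eq: "F i - aI s i i *\<^sub>R ((dt / \<epsilon>) *\<^sub>R Q (F i))
        = (dI0_ARS s i *\<^sub>R fn + dE0_ARS s i *\<^sub>R (dt *\<^sub>R T fn))
          + (\<Sum>j\<in>{2..<i}. dI s i j *\<^sub>R F j + dE s i j *\<^sub>R (dt *\<^sub>R T (F j)))"
      using F1
      by (subst stage_without_implicit_history[where m = 2 and n = "stages s"
            and D = "\<lambda>j. dt *\<^sub>R T (F j)" and q = "\<lambda>j. (dt / \<epsilon>) *\<^sub>R Q (F j)", OF _ stage])
         (use nz i in \<open>auto simp: dI0_ARS_def dI_def sum.distrib algebra_simps \<close>)
    have "nonneg ev (dI0_ARS s i *\<^sub>R fn + dE0_ARS s i *\<^sub>R (dt *\<^sub>R T fn))"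
    proof (rule nonneg_Euler_combination[OF fs P1 \<open>C > 0\<close> \<open>dt > 0\<close>])
      show "dI0_ARS s i \<ge> 0" "dE0_ARS s i \<ge> 0" using pos i by (auto simp: positivity_ARS_def)
      have "c_sch_ARS s \<le> ratio (dI0_ARS s i) (dE0_ARS s i)"
        unfolding c_sch_ARS_def by (rule min.coboundedI1, rule INF_lower[OF i])
      then show "ereal dt \<le> ratio (dI0_ARS s i) (dE0_ARS s i) * ereal C"
        using dt \<open>C > 0\<close> by (meson ereal_mult_right_mono ereal_less_eq(5) less_imp_le order_trans)
    qed (rule fn)
    moreover have "nonneg ev (dI s i j *\<^sub>R F j + dE s i j *\<^sub>R (dt *\<^sub>R T (F j)))"
      if j: "j \<in> {2..<i}" for j
    proof (rule nonneg_Euler_combination[OF fs P1 \<open>C > 0\<close> \<open>dt > 0\<close>])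
      have i3: "i \<in> {3..stages s}" using i j by auto
      then show "dI s i j \<ge> 0" "dE s i j \<ge> 0" using pos j by (auto simp: positivity_ARS_def)
      have "c_sch_ARS s \<le> ratio (dI s i j) (dE s i j)"
        unfolding c_sch_ARS_def
        by (rule min.coboundedI2, rule INF_lower2[OF i3], rule INF_lower[OF j])
      then show "ereal dt \<le> ratio (dI s i j) (dE s i j) * ereal C"
        using dt \<open>C > 0\<close> by (meson ereal_mult_right_mono ereal_less_eq(5) less_imp_le order_trans)
      show "nonneg ev (F j)" using less j by auto
    qed
    ultimately have "nonneg ev (F i - aI s i i *\<^sub>R ((dt / \<epsilon>) *\<^sub>R Q (F i)))"
      unfolding eq by (blast intro: nonneg_add[OF fs] nonneg_sum[OF fs])
    then show ?thesis
      using nonneg_implicit_solve[OF P2 a[OF i] \<open>\<epsilon> > 0\<close> \<open>dt > 0\<close>] by blast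
  qed
qed

text \<open>Global stiff accuracy makes the final quadrature repeat the last stage; the explicit diagonal
  entry, absent from the stage, is zero.\<close>

lemma uncorrected_eq_last_stage:
  assumes step: "scheme_step T Q \<epsilon> s \<alpha> dt fn F ft fs fnew"
    and "imex_tableau s" and "GSA s" and "stages s \<ge> 1"
  shows "ft = F (stages s)"
proof -
  let ?n = "stages s"
  have "aE s ?n ?n = 0" using assms by (simp add: imex_tableau_def)
  moreover have "{1..?n} = insert ?n {1..<?n}" using assms(4) by auto
  ultimately have "(\<Sum>i\<in>{1..?n}. wE s i *\<^sub>R T (F i)) = (\<Sum>i\<in>{1..<?n}. aE s ?n i *\<^sub>R T (F i))"
    using \<open>GSA s\<close> by (auto simp: GSA_def intro!: sum.cong)
  moreover have "(\<Sum>i\<in>{1..?n}. wI s i *\<^sub>R ((1/\<epsilon>) *\<^sub>R Q (F i)))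
      = (\<Sum>i\<in>{1..?n}. aI s ?n i *\<^sub>R ((1/\<epsilon>) *\<^sub>R Q (F i)))"
    using \<open>GSA s\<close> by (intro sum.cong) (auto simp: GSA_def)
  moreover have "?n \<in> {1..?n}" using assms(4) by simp
  ultimately show ?thesis using step unfolding scheme_step_def by metis
qed

text \<open>The correction is one more implicit solve.  The case \<open>fs = fnew\<close> is separate because \<open>P3\<close> needs
  nonnegativity of the linearization point beforehand, which is then the claim itself.\<close>

lemma corrected_nonneg:
  assumes P3: "P3 ev Q" and P4: "P4 ev Q" and "\<alpha> \<ge> 0" and "nonneg ev ft"
    and eq: "fnew = ft - (\<alpha> * dt^2 * (1/\<epsilon>^2)) *\<^sub>R op_deriv Q fs (Q fnew)"
    and "fs = fnew \<or> nonneg ev fs"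
  shows "nonneg ev fnew"
proof -
  let ?b = "\<alpha> * dt^2 * (1/\<epsilon>^2)"
  have b: "?b \<ge> 0" using \<open>\<alpha> \<ge> 0\<close> by simp
  have eq': "fnew + ?b *\<^sub>R op_deriv Q fs (Q fnew) = ft"
    by (subst (1) eq) simp
  from assms(6) show ?thesis
  proof
    assume "fs = fnew"
    then show ?thesis using P4 b eq' \<open>nonneg ev ft\<close> unfolding P4_def by blast
  next
    assume "nonneg ev fs"
    then show ?thesis using P3 b eq' \<open>nonneg ev ft\<close> unfolding P3_def by blast
  qed
qed

lemma positivity_preserving_if_positivity_conditions:
  assumes fs: "function_space ev" and "C > 0" and "P1 ev T C" and "P2 ev Q" and "P3 ev Q" and "P4 ev Q"
    and "\<epsilon> > 0" and "\<alpha> \<ge> 0"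
    and "imex_tableau s" and "GSA s" and n: "stages s \<ge> 1"
    and types: "type_A s \<and> positivity_A s \<or> type_ARS s \<and> positivity_ARS s"
  shows "positivity_preserving ev T Q C \<epsilon> s \<alpha>"
  unfolding positivity_preserving_def
proof (intro allI impI)
  fix dt fn F ft fs fnew
  assume "dt > 0" and step: "scheme_step T Q \<epsilon> s \<alpha> dt fn F ft fs fnew"
    and fn: "nonneg ev fn" and dt: "ereal dt \<le> c_sch s * ereal C"
  have F: "\<forall>i\<in>{1..stages s}. nonneg ev (F i)"
    using types
  proof
    assume A: "type_A s \<and> positivity_A s"
    then have "ereal dt \<le> c_sch_A s * ereal C" using dt by (simp add: c_sch_def)
    with A show ?thesis
      using stages_nonneg_type_A[OF assms(1,3,4,2,7) \<open>dt > 0\<close> step _ fn] by blast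
  next
    assume ARS: "type_ARS s \<and> positivity_ARS s"
    then have "ereal dt \<le> c_sch_ARS s * ereal C"
      using dt not_type_A_if_type_ARS[OF _ n] by (simp add: c_sch_def)
    with ARS show ?thesis
      using stages_nonneg_type_ARS[OF assms(1,3,4,2,7) \<open>dt > 0\<close> step _ _ fn] by blast
  qed
  moreover have ft: "nonneg ev ft"
    using F n uncorrected_eq_last_stage[OF step \<open>imex_tableau s\<close> \<open>GSA s\<close> n] by simp
  moreover have "nonneg ev fnew"
  proof (rule corrected_nonneg[OF \<open>P3 ev Q\<close> \<open>P4 ev Q\<close> \<open>\<alpha> \<ge> 0\<close> ft])
    show "fnew = ft - (\<alpha> * dt^2 * (1/\<epsilon>^2)) *\<^sub>R op_deriv Q fs (Q fnew)"
      using step unfolding scheme_step_def by blast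
    have "fs \<in> {fn, ft, fnew} \<union> F ` {1..stages s}"
      using step unfolding scheme_step_def by blast
    then show "fs = fnew \<or> nonneg ev fs" using F fn ft by auto
  qed
  ultimately show "(\<forall>i\<in>{1..stages s}. nonneg ev (F i)) \<and> nonneg ev ft \<and> nonneg ev fnew" by blast
qed

section \<open>Orders of vanishing as the step size tends to zero\<close>

text \<open>Remainders take values in a normed space, whereas the Landau symbols are stated for scalar
  functions; this is $O(d^k)$ as $d \to 0^+$ for vector-valued \<open>e\<close>, with a nonnegative
  constant so that bounds can be multiplied.\<close>

definition step_bigo :: "nat \<Rightarrow> (real \<Rightarrow> 'a::real_normed_vector) \<Rightarrow> bool" where
  "step_bigo k e \<longleftrightarrow> (\<exists>c\<ge>0. \<forall>\<^sub>F d in at_right 0. norm (e d) \<le> c * d ^ k)"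

lemma step_bigo_I:
  assumes "\<forall>\<^sub>F d in at_right 0. norm (e d) \<le> c * d ^ k"
  shows "step_bigo k e"
proof -
  have "\<forall>\<^sub>F d in at_right 0. norm (e d) \<le> max c 0 * d ^ k"
    using assms eventually_at_right_less
  proof eventually_elim
    case (elim d)
    then have "c * d ^ k \<le> max c 0 * d ^ k"
      by (intro mult_right_mono) auto
    with elim show ?case by linarith
  qed
  then show ?thesis unfolding step_bigo_def by (intro exI[of _ "max c 0"]) auto
qed

lemma step_bigo_iff_bigo: "step_bigo k e \<longleftrightarrow> (\<lambda>d. norm (e d)) \<in> O[at_right 0](\<lambda>d. d ^ k)"
proof
  assume "step_bigo k e"
  then obtain c where c: "\<forall>\<^sub>F d in at_right 0. norm (e d) \<le> c * d ^ k"
    unfolding step_bigo_def by blast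
  show "(\<lambda>d. norm (e d)) \<in> O[at_right 0](\<lambda>d. d ^ k)"
    by (rule bigoI[of _ c]) (use c eventually_at_right_less in eventually_elim, simp)
next
  assume "(\<lambda>d. norm (e d)) \<in> O[at_right 0](\<lambda>d. d ^ k)"
  then obtain c where c: "\<forall>\<^sub>F d in at_right 0. norm (norm (e d)) \<le> c * norm (d ^ k)"
    by (rule landau_o.bigE)
  show "step_bigo k e"
    by (rule step_bigo_I[of _ c]) (use c eventually_at_right_less in eventually_elim, simp)
qed

lemma step_bigo_dominated:
  assumes "step_bigo k e" and "\<forall>\<^sub>F d in at_right 0. norm (e' d) \<le> norm (e d)"
  shows "step_bigo k e'"
proof -
  obtain c where c: "\<forall>\<^sub>F d in at_right 0. norm (e d) \<le> c * d ^ k"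
    using assms(1) unfolding step_bigo_def by blast
  show ?thesis
    by (rule step_bigo_I[of _ c]) (use c assms(2) in eventually_elim, simp)
qed

lemma step_bigo_cong:
  assumes "step_bigo k e" and "\<forall>\<^sub>F d in at_right 0. e' d = e d"
  shows "step_bigo k e'"
  by (rule step_bigo_dominated[OF assms(1)]) (use assms(2) in eventually_elim, simp)

lemma step_bigo_zero: "step_bigo k (\<lambda>_. 0)"
  by (rule step_bigo_I[of _ 0]) simp

lemma step_bigo_const: "step_bigo 0 (\<lambda>_. v)"
  by (rule step_bigo_I[of _ "norm v"]) simp

lemma step_bigo_add:
  assumes "step_bigo k e" and "step_bigo k e'"
  shows "step_bigo k (\<lambda>d. e d + e' d)"
proof -
  obtain c c' where "\<forall>\<^sub>F d in at_right 0. norm (e d) \<le> c * d ^ k"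
    and "\<forall>\<^sub>F d in at_right 0. norm (e' d) \<le> c' * d ^ k"
    using assms unfolding step_bigo_def by blast
  then have "\<forall>\<^sub>F d in at_right 0. norm (e d + e' d) \<le> (c + c') * d ^ k"
  proof eventually_elim
    case (elim d)
    then show ?case using norm_triangle_ineq[of "e d" "e' d"]
      by (simp add: distrib_right)
  qed
  then show ?thesis by (rule step_bigo_I)
qed

lemma step_bigo_bounded_bilinear:
  assumes "bounded_bilinear p" and "step_bigo k e" and "step_bigo l e'"
  shows "step_bigo (k + l) (\<lambda>d. p (e d) (e' d))"
proof -
  obtain K where K: "\<And>x y. norm (p x y) \<le> norm x * norm y * K" "K \<ge> 0"
    using bounded_bilinear.nonneg_bounded[OF assms(1)] by blast
  obtain c c' where c: "c \<ge> 0" and e: "\<forall>\<^sub>F d in at_right 0. norm (e d) \<le> c * d ^ k"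
    and e': "\<forall>\<^sub>F d in at_right 0. norm (e' d) \<le> c' * d ^ l"
    using assms unfolding step_bigo_def by blast
  have "\<forall>\<^sub>F d in at_right 0. norm (p (e d) (e' d)) \<le> (c * c' * K) * d ^ (k + l)"
    using e e' eventually_at_right_less
  proof eventually_elim
    case (elim d)
    have "norm (p (e d) (e' d)) \<le> norm (e d) * norm (e' d) * K" by (rule K)
    also have "\<dots> \<le> (c * d ^ k) * (c' * d ^ l) * K"
      using elim K(2) c by (intro mult_right_mono mult_mono) auto
    finally show ?case by (simp add: power_add mult_ac)
  qed
  then show ?thesis by (rule step_bigo_I)
qed

lemma step_bigo_bounded_linear:
  assumes "bounded_linear L" and "step_bigo k e"
  shows "step_bigo k (\<lambda>d. L (e d))"
proof -
  obtain B where B: "\<And>x. norm (L x) \<le> norm x * B"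
    using bounded_linear.bounded[OF assms(1)] by blast
  obtain c where c: "c \<ge> 0" "\<forall>\<^sub>F d in at_right 0. norm (e d) \<le> c * d ^ k"
    using assms(2) unfolding step_bigo_def by blast
  from c(2) have "\<forall>\<^sub>F d in at_right 0. norm (L (e d)) \<le> (c * max B 0) * d ^ k"
  proof eventually_elim
    case (elim d)
    have "norm (L (e d)) \<le> norm (e d) * B" by (rule B)
    also have "\<dots> \<le> (c * d ^ k) * max B 0"
      using elim norm_ge_zero[of "e d"] by (intro order_trans[OF mult_left_mono mult_right_mono]) auto
    finally show ?case by (simp add: mult_ac)
  qed
  then show ?thesis by (rule step_bigo_I)
qed

lemma step_bigo_scaleR: "step_bigo k e \<Longrightarrow> step_bigo k (\<lambda>d. r *\<^sub>R e d)"
  by (rule step_bigo_bounded_linear[OF bounded_linear_scaleR_right])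

lemma step_bigo_diff: "step_bigo k e \<Longrightarrow> step_bigo k e' \<Longrightarrow> step_bigo k (\<lambda>d. e d - e' d)"
  using step_bigo_add[of k e "\<lambda>d. (-1) *\<^sub>R e' d"] step_bigo_scaleR[of k e' "-1"] by simp

lemma step_bigo_sum: "(\<And>i. i \<in> I \<Longrightarrow> step_bigo k (e i)) \<Longrightarrow> step_bigo k (\<lambda>d. \<Sum>i\<in>I. e i d)"
  by (induction I rule: infinite_finite_induct) (auto intro: step_bigo_zero step_bigo_add)

lemma step_bigo_power_scaleR:
  assumes "step_bigo k e"
  shows "step_bigo (l + k) (\<lambda>d. d ^ l *\<^sub>R e d)"
proof -
  have "step_bigo l (\<lambda>d::real. d ^ l)"
    by (rule step_bigo_I[of _ 1]) (use eventually_at_right_less[of "0::real"] in eventually_elim, simp)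
  from step_bigo_bounded_bilinear[OF bounded_bilinear_scaleR this assms] show ?thesis .
qed

lemma step_bigo_step: "step_bigo k e \<Longrightarrow> step_bigo (Suc k) (\<lambda>d. d *\<^sub>R e d)"
  using step_bigo_power_scaleR[of k e 1] by simp

lemma step_bigo_mono:
  assumes "step_bigo k e" and "l \<le> k"
  shows "step_bigo l e"
proof -
  obtain c where c: "c \<ge> 0" "\<forall>\<^sub>F d in at_right 0. norm (e d) \<le> c * d ^ k"
    using assms(1) unfolding step_bigo_def by blast
  have "\<forall>\<^sub>F d in at_right (0::real). d < 1"
    using eventually_at_right_real[of 0 1] by (auto elim: eventually_mono)
  with c(2) have "\<forall>\<^sub>F d in at_right 0. norm (e d) \<le> c * d ^ l"
    using eventually_at_right_less
  proof eventually_elim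
    case (elim d)
    then have "d ^ k \<le> d ^ l" using assms(2) by (intro power_decreasing) auto
    with c(1) have "c * d ^ k \<le> c * d ^ l" by (rule mult_left_mono[rotated])
    with elim show ?case by linarith
  qed
  then show ?thesis by (rule step_bigo_I)
qed

lemma step_bigo_tendsto_zero:
  assumes "step_bigo 1 e"
  shows "(e \<longlongrightarrow> 0) (at_right 0)"
proof -
  obtain c where c: "\<forall>\<^sub>F d in at_right 0. norm (e d) \<le> c * d"
    using assms unfolding step_bigo_def by auto
  have "((\<lambda>d. c * d) \<longlongrightarrow> 0) (at_right (0::real))"
    by (auto intro!: tendsto_eq_intros)
  with c show ?thesis by (rule Lim_null_comparison)
qed

text \<open>The mean value inequality gains one order.  It takes the place of Taylor's theorem with integral
  remainder, for which the space would have to be complete.  The derivative is compared on the open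
  interval only, because \<open>step_bigo k g'\<close> gives no information about \<open>g' 0\<close>.\<close>

lemma step_bigo_integrate:
  assumes "\<tau> > 0"
    and der: "\<And>t. t \<in> {0..\<tau>} \<Longrightarrow> (g has_vector_derivative g' t) (at t within {0..\<tau>})"
    and "g 0 = 0" and "step_bigo k g'"
  shows "step_bigo (Suc k) g"
proof -
  obtain c where c: "c \<ge> 0" "\<forall>\<^sub>F d in at_right 0. norm (g' d) \<le> c * d ^ k"
    using assms(4) unfolding step_bigo_def by blast
  then obtain b where b: "b > 0" "\<And>d. 0 < d \<Longrightarrow> d < b \<Longrightarrow> norm (g' d) \<le> c * d ^ k"
    unfolding eventually_at_right_field by blast
  have "\<forall>\<^sub>F d in at_right 0. d < b"
    using eventually_at_right_real[OF b(1)] by (auto elim: eventually_mono)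
  moreover have "\<forall>\<^sub>F d in at_right 0. d < \<tau>"
    using eventually_at_right_real[OF assms(1)] by (auto elim: eventually_mono)
  ultimately have "\<forall>\<^sub>F d in at_right 0. norm (g d) \<le> c * d ^ Suc k"
    using eventually_at_right_less
  proof eventually_elim
    case (elim d)
    have "norm (g d - g 0) \<le> (\<lambda>t. c * d ^ k * t) d - (\<lambda>t. c * d ^ k * t) 0"
    proof (rule differentiable_bound_general[where f' = g' and \<phi>' = "\<lambda>_. c * d ^ k"])
      have "continuous_on {0..\<tau>} g"
        by (rule continuous_on_vector_derivative) (rule der)
      then show "continuous_on {0..d} g"
        by (rule continuous_on_subset) (use elim in auto)
      show "continuous_on {0..d} (\<lambda>t. c * d ^ k * t)" by (intro continuous_intros)
      fix x assume x: "0 < x" "x < d"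
      have "at x within {0..\<tau>} = at x" using x elim by (intro at_within_Icc_at) auto
      then show "(g has_vector_derivative g' x) (at x)" using der[of x] x elim by simp
      show "((\<lambda>t. c * d ^ k * t) has_vector_derivative c * d ^ k) (at x)"
        by (auto intro!: derivative_eq_intros
            simp: has_real_derivative_iff_has_vector_derivative[symmetric])
      have "norm (g' x) \<le> c * x ^ k" using b(2)[of x] x elim by simp
      also have "\<dots> \<le> c * d ^ k" using c(1) x by (intro mult_left_mono power_mono) auto
      finally show "norm (g' x) \<le> c * d ^ k" .
    qed (use elim in auto)
    then show ?case using assms(3) by (simp add: mult_ac)
  qed
  then show ?thesis by (rule step_bigo_I)
qed

section \<open>Local expansions of a twice continuously differentiable operator\<close>

text \<open>The directional limit in \<open>op_deriv\<close> is a \<open>Lim\<close>, so it has a known value only once the limit is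
  shown to exist; a Frechet derivative provides it.\<close>

lemma op_deriv_eq:
  assumes "(G has_derivative G') (at x)"
  shows "op_deriv G x v = G' v"
proof -
  have "((\<lambda>\<delta>::real. x + \<delta> *\<^sub>R v) has_derivative (\<lambda>\<delta>. \<delta> *\<^sub>R v)) (at 0)"
    by (auto intro!: derivative_eq_intros)
  moreover have "(G has_derivative G') (at (x + (0::real) *\<^sub>R v))" using assms by simp
  ultimately have "((\<lambda>\<delta>::real. G (x + \<delta> *\<^sub>R v)) has_derivative (\<lambda>\<delta>. G' (\<delta> *\<^sub>R v))) (at 0)"
    by (rule has_derivative_compose)
  then have "((\<lambda>h. norm (G (x + h *\<^sub>R v) - G x - G' (h *\<^sub>R v)) / norm h) \<longlongrightarrow> 0) (at (0::real))"
    by (simp add: has_derivative_at)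
  then have "((\<lambda>h. norm ((G (x + h *\<^sub>R v) - G x) /\<^sub>R h - G' v)) \<longlongrightarrow> 0) (at (0::real))"
  proof (rule Lim_transform_eventually)
    have "norm (G (x + h *\<^sub>R v) - G x - G' (h *\<^sub>R v)) / norm h
        = norm ((G (x + h *\<^sub>R v) - G x) /\<^sub>R h - G' v)" if "h \<noteq> 0" for h :: real
    proof -
      have "(G (x + h *\<^sub>R v) - G x) /\<^sub>R h - G' v
          = (G (x + h *\<^sub>R v) - G x - G' (h *\<^sub>R v)) /\<^sub>R h"
        using that by (simp add: linear_scale[OF has_derivative_linear[OF assms]] scaleR_diff_right)
      then show ?thesis by (simp add: divide_inverse mult.commute)
    qed
    then show "\<forall>\<^sub>F h in at (0::real). norm (G (x + h *\<^sub>R v) - G x - G' (h *\<^sub>R v)) / norm h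
        = norm ((G (x + h *\<^sub>R v) - G x) /\<^sub>R h - G' v)"
      by (auto simp: eventually_at_filter)
  qed
  then have "((\<lambda>h. (G (x + h *\<^sub>R v) - G x) /\<^sub>R h) \<longlongrightarrow> G' v) (at (0::real))"
    by (simp add: tendsto_norm_zero_iff LIM_zero_iff)
  then show ?thesis unfolding op_deriv_def by (intro tendsto_Lim) auto
qed

text \<open>The second derivative is continuous, hence bounded on a small ball around \<open>u0\<close>.  The mean value
  inequality on the ball makes the first derivative Lipschitz at \<open>u0\<close>, and on the segment from
  \<open>u0\<close> to \<open>x\<close> it then gives the quadratic Taylor remainder.  From here on these two bounds replace
  \<open>C2_on\<close>.\<close>

lemma C2_on_expansion:
  fixes G :: "'a::real_normed_vector \<Rightarrow> 'a"
  assumes "C2_on G U" and "open U" and "u0 \<in> U"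
  obtains L :: "'a \<Rightarrow>\<^sub>L 'a" and K where "K \<ge> 0"
    and "\<forall>\<^sub>F x in nhds u0. norm (G x - G u0 - L (x - u0)) \<le> K * norm (x - u0) ^ 2"
    and "\<forall>\<^sub>F x in nhds u0. \<forall>v. norm (op_deriv G x v - L v) \<le> K * norm (x - u0) * norm v"
proof -
  obtain G' :: "'a \<Rightarrow> 'a \<Rightarrow>\<^sub>L 'a" and G'' :: "'a \<Rightarrow> 'a \<Rightarrow>\<^sub>L ('a \<Rightarrow>\<^sub>L 'a)"
    where G': "\<And>f. f \<in> U \<Longrightarrow> (G has_derivative G' f) (at f)"
      and G'': "\<And>f. f \<in> U \<Longrightarrow> (G' has_derivative G'' f) (at f)"
      and cont: "continuous_on U G''"
    using assms(1) unfolding C2_on_def by metis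
  define K where "K = norm (G'' u0) + 1"
  have "(G'' \<longlongrightarrow> G'' u0) (nhds u0)"
    using cont assms(2,3) by (simp add: continuous_on_eq_continuous_at continuous_at
        tendsto_at_iff_tendsto_nhds)
  then have "\<forall>\<^sub>F x in nhds u0. norm (G'' x) < K"
    by (intro order_tendstoD(2)[OF tendsto_norm]) (auto simp: K_def)
  moreover have "\<forall>\<^sub>F x in nhds u0. x \<in> U"
    using assms(2,3) by (simp add: eventually_nhds_in_open)
  ultimately have "\<forall>\<^sub>F x in nhds u0. norm (G'' x) < K \<and> x \<in> U"
    by eventually_elim simp
  then obtain r where r: "r > 0" "\<And>x. dist x u0 < r \<Longrightarrow> norm (G'' x) < K \<and> x \<in> U"
    by (auto simp: eventually_nhds_metric)
  have G'_lip: "norm (G' x - G' u0) \<le> K * norm (x - u0)" if "dist x u0 < r" for x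
  proof (rule differentiable_bound[where S = "ball u0 r" and f = G' and f' = "\<lambda>x. G'' x"
        and B = K and x = x and y = u0])
    fix y assume "y \<in> ball u0 r"
    then have y: "norm (G'' y) < K \<and> y \<in> U"
      using r(2)[of y] by (simp add: dist_commute)
    show "(G' has_derivative G'' y) (at y within ball u0 r)"
      using y by (intro has_derivative_at_withinI[OF G'']) simp
    show "onorm (G'' y) \<le> K" using y by (simp add: norm_blinfun.rep_eq)
  qed (use that r(1) in \<open>auto simp: dist_commute\<close>)
  have near: "\<forall>\<^sub>F x in nhds u0. dist x u0 < r"
    unfolding eventually_nhds_metric using r(1) by blast
  show ?thesis
  proof (rule that[of K "G' u0"])
    show "K \<ge> 0" by (simp add: K_def)
    show "\<forall>\<^sub>F x in nhds u0. \<forall>v. norm (op_deriv G x v - G' u0 v) \<le> K * norm (x - u0) * norm v"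
      using near
    proof eventually_elim
      case (elim x)
      then have "x \<in> U" using r(2) by blast
      then have "op_deriv G x v = G' x v" for v by (intro op_deriv_eq G')
      moreover have "norm (G' x v - G' u0 v) \<le> K * norm (x - u0) * norm v" for v
      proof -
        have "norm ((G' x - G' u0) v) \<le> norm (G' x - G' u0) * norm v" by (rule norm_blinfun)
        also have "\<dots> \<le> K * norm (x - u0) * norm v"
          by (intro mult_right_mono G'_lip elim) simp
        finally show ?thesis by (simp add: minus_blinfun.rep_eq)
      qed
      ultimately show ?case by simp
    qed
    show "\<forall>\<^sub>F x in nhds u0. norm (G x - G u0 - G' u0 (x - u0)) \<le> K * norm (x - u0) ^ 2"
      using near
    proof eventually_elim
      case (elim x)
      let ?S = "closed_segment u0 x"
      have S: "dist y u0 < r \<and> norm (y - u0) \<le> norm (x - u0)" if "y \<in> ?S" for y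
        using segment_bound(1)[OF that] elim by (simp add: dist_norm)
      have "norm (G x - G u0 - G' u0 (x - u0)) \<le> norm (x - u0) * (K * norm (x - u0))"
      proof (rule differentiable_bound_linearization[where S = ?S and f = G and f' = "\<lambda>x. G' x"
            and a = u0 and b = x and ?x0.0 = u0])
        fix y assume y: "y \<in> ?S"
        then have "dist y u0 < r" using S by blast
        then show "(G has_derivative G' y) (at y within ?S)"
          using r(2) by (blast intro: has_derivative_at_withinI[OF G'])
        have "onorm (blinfun_apply (G' y) - blinfun_apply (G' u0)) = norm (G' y - G' u0)"
          by (simp add: norm_blinfun.rep_eq minus_blinfun.rep_eq fun_diff_def)
        also have "\<dots> \<le> K * norm (y - u0)" using S[OF y] by (intro G'_lip) simp
        also have "\<dots> \<le> K * norm (x - u0)"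
          using S[OF y] by (intro mult_left_mono) (auto simp: K_def)
        finally show "onorm (blinfun_apply (G' y) - blinfun_apply (G' u0)) \<le> K * norm (x - u0)" .
      qed (auto simp: closed_segment_def algebra_simps intro!: exI)
      then show ?case by (simp add: power2_eq_square mult_ac)
    qed
  qed
qed

lemma step_bigo_linearize:
  fixes G :: "'a::real_normed_vector \<Rightarrow> 'a" and L :: "'a \<Rightarrow>\<^sub>L 'a"
  assumes exp: "\<forall>\<^sub>F x in nhds u0. norm (G x - G u0 - L (x - u0)) \<le> K * norm (x - u0) ^ 2"
    and g: "step_bigo 1 (\<lambda>d. g d - u0)"
  shows "step_bigo 2 (\<lambda>d. G (g d) - G u0 - L (g d - u0))"
proof -
  have "(g \<longlongrightarrow> u0) (at_right 0)"
    using step_bigo_tendsto_zero[OF g] by (simp add: LIM_zero_iff)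
  then have ev: "\<forall>\<^sub>F d in at_right 0.
      norm (G (g d) - G u0 - L (g d - u0)) \<le> K * norm (g d - u0) ^ 2"
    by (rule eventually_compose_filterlim[OF exp])
  have n: "step_bigo 1 (\<lambda>d. norm (g d - u0))" using g unfolding step_bigo_def by simp
  have "step_bigo 2 (\<lambda>d. K * (norm (g d - u0) * norm (g d - u0)))"
    using step_bigo_scaleR[OF step_bigo_bounded_bilinear[OF bounded_bilinear_mult n n], of K]
    by (simp add: numeral_2_eq_2)
  then show ?thesis
    by (rule step_bigo_dominated) (use ev in eventually_elim, simp add: power2_eq_square)
qed

lemma step_bigo_lipschitz:
  fixes G :: "'a::real_normed_vector \<Rightarrow> 'a" and L :: "'a \<Rightarrow>\<^sub>L 'a"
  assumes "\<forall>\<^sub>F x in nhds u0. norm (G x - G u0 - L (x - u0)) \<le> K * norm (x - u0) ^ 2"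
    and g: "step_bigo 1 (\<lambda>d. g d - u0)"
  shows "step_bigo 1 (\<lambda>d. G (g d) - G u0)"
  using step_bigo_add[OF step_bigo_mono[OF step_bigo_linearize[OF assms]]
      step_bigo_bounded_linear[OF blinfun.bounded_linear_right[of L] g]]
  by simp

text \<open>The form in which Taylor expansion is used below: an argument known to first order in the step
  size, with error $O(d^2)$, has an image known to first order with the same error.\<close>

lemma step_bigo_linearize_first_order:
  fixes G :: "'a::real_normed_vector \<Rightarrow> 'a" and L :: "'a \<Rightarrow>\<^sub>L 'a"
  assumes exp: "\<forall>\<^sub>F x in nhds u0. norm (G x - G u0 - L (x - u0)) \<le> K * norm (x - u0) ^ 2"
    and g: "step_bigo 1 (\<lambda>d. g d - u0)" and g2: "step_bigo 2 (\<lambda>d. g d - u0 - d *\<^sub>R p)"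
  shows "step_bigo 2 (\<lambda>d. G (g d) - G u0 - d *\<^sub>R L p)"
proof -
  have "step_bigo 2 (\<lambda>d. L (g d - u0 - d *\<^sub>R p))"
    by (rule step_bigo_bounded_linear[OF blinfun.bounded_linear_right g2])
  from step_bigo_add[OF step_bigo_linearize[OF exp g] this] show ?thesis
    by (simp add: blinfun.diff_right blinfun.scaleR_right)
qed

text \<open>Bootstrapping along the equation \<open>u' = G u\<close>: each expansion of \<open>u\<close> gives one of \<open>u'\<close>, and
  integration turns it into an expansion of \<open>u\<close> that is one order better.  Three rounds start from
  the boundedness of \<open>u'\<close> near the initial time.\<close>

lemma exact_solution_expansion:
  fixes G :: "'a::real_normed_vector \<Rightarrow> 'a" and L :: "'a \<Rightarrow>\<^sub>L 'a"
  assumes exp: "\<forall>\<^sub>F x in nhds (u tn). norm (G x - G (u tn) - L (x - u tn)) \<le> K * norm (x - u tn) ^ 2"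
    and "\<tau> > 0"
    and sol: "\<And>t. t \<in> {tn..tn+\<tau>} \<Longrightarrow> (u has_vector_derivative G (u t)) (at t within {tn..tn+\<tau>})"
  shows "step_bigo 3 (\<lambda>d. u (tn + d) - u tn - d *\<^sub>R G (u tn) - (d^2 / 2) *\<^sub>R L (G (u tn)))"
proof -
  define v where "v d = u (tn + d)" for d
  have v0: "v 0 = u tn" by (simp add: v_def)
  have dv: "(v has_vector_derivative G (v t)) (at t within {0..\<tau>})" if "t \<in> {0..\<tau>}" for t
  proof -
    have "((\<lambda>d. tn + d) has_vector_derivative 1) (at t within {0..\<tau>})"
      by (auto intro!: derivative_eq_intros)
    moreover have "(\<lambda>d. tn + d) ` {0..\<tau>} = {tn..tn+\<tau>}" by simp
    ultimately have "((u \<circ> (\<lambda>d. tn + d)) has_vector_derivative 1 *\<^sub>R G (u (tn + t)))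
        (at t within {0..\<tau>})"
      using sol[of "tn + t"] that by (intro vector_diff_chain_within) (auto simp: add.commute)
    then show ?thesis by (simp add: v_def[abs_def] o_def)
  qed
  have lim: "(v \<longlongrightarrow> u tn) (at_right 0)"
  proof -
    have "continuous_on {0..\<tau>} v" by (rule continuous_on_vector_derivative) (rule dv)
    then have "(v \<longlongrightarrow> v 0) (at 0 within {0..\<tau>})"
      using assms(2) by (auto simp: continuous_on_def)
    then show ?thesis using assms(2) by (simp add: v0 at_within_Icc_at_right)
  qed
  have "step_bigo 0 (\<lambda>d. G (v d) - G (u tn))"
  proof -
    have 1: "\<forall>\<^sub>F d in at_right 0. norm (G (v d) - G (u tn) - L (v d - u tn)) \<le> K * norm (v d - u tn) ^ 2"
      by (rule eventually_compose_filterlim[OF exp lim])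
    have "((\<lambda>d. norm (v d - u tn)) \<longlongrightarrow> 0) (at_right 0)"
      using lim by (simp add: LIM_zero_iff tendsto_norm_zero)
    then have 2: "\<forall>\<^sub>F d in at_right 0. norm (v d - u tn) < 1"
      by (rule order_tendstoD) simp
    have "\<forall>\<^sub>F d in at_right 0. norm (G (v d) - G (u tn)) \<le> (\<bar>K\<bar> + norm L) * d ^ 0"
      using 1 2
    proof eventually_elim
      case (elim d)
      have "norm (G (v d) - G (u tn)) \<le> norm (G (v d) - G (u tn) - L (v d - u tn)) + norm (L (v d - u tn))"
        by (metis diff_add_cancel norm_triangle_ineq)
      also have "\<dots> \<le> K * norm (v d - u tn) ^ 2 + norm L * norm (v d - u tn)"
        using elim norm_blinfun by (intro add_mono) auto
      also have "\<dots> \<le> \<bar>K\<bar> * 1 + norm L * 1"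
        using elim by (intro add_mono mult_mono power_le_one) auto
      finally show ?case by simp
    qed
    then show ?thesis by (rule step_bigo_I)
  qed
  then have "step_bigo (Suc 0) (\<lambda>d. v d - u tn - d *\<^sub>R G (u tn))"
    by (rule step_bigo_integrate[OF assms(2), rotated 2]) (auto simp: v0 intro!: derivative_eq_intros dv)
  from step_bigo_add[OF this step_bigo_step[OF step_bigo_const[of "G (u tn)"]]]
  have o1: "step_bigo 1 (\<lambda>d. v d - u tn)" by simp
  from step_bigo_lipschitz[OF exp o1]
  have "step_bigo (Suc 1) (\<lambda>d. v d - u tn - d *\<^sub>R G (u tn))"
    by (rule step_bigo_integrate[OF assms(2), rotated 2]) (auto simp: v0 intro!: derivative_eq_intros dv)
  then have o2: "step_bigo 2 (\<lambda>d. v d - u tn - d *\<^sub>R G (u tn))" by (simp add: numeral_2_eq_2)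
  from step_bigo_linearize_first_order[OF exp o1 o2]
  have "step_bigo (Suc 2) (\<lambda>d. v d - u tn - d *\<^sub>R G (u tn) - (d^2 / 2) *\<^sub>R L (G (u tn)))"
    by (rule step_bigo_integrate[OF assms(2), rotated 2])
       (auto simp: v0 intro!: derivative_eq_intros dv)
  then show ?thesis by (simp add: v_def)
qed

section \<open>Second-order accuracy of the corrected scheme\<close>

text \<open>All quantities are expanded in the step size \<open>d\<close> at \<open>u0\<close>.  The explicit and implicit weights
  contract the first-order stage displacements \<open>P i\<close> to the second-order coefficient of the uncorrected
  value, which by the order conditions is half of \<open>L (G u0)\<close>, as for the exact solution, plus the
  excess $\alpha \varepsilon^{-2} Q'(u_0) Q(u_0)$.  The correction subtracts the same term up to
  $O(d^3)$, whichever point within $O(d)$ of \<open>u0\<close> it is linearized at.\<close>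

lemma second_order_accurate_if_order_conditions:
  assumes oc: "order_conditions s \<alpha>"
  shows "second_order_accurate T Q \<epsilon> s \<alpha>"
  unfolding second_order_accurate_def
proof (intro allI impI)
  fix u :: "real \<Rightarrow> 'a" and tn \<tau> U F ft fs fnew
  define u0 where "u0 = u tn"
  define e where "e = 1 / \<epsilon>"
  assume U: "open U" "u tn \<in> U" and C2: "C2_on T U" "C2_on Q U" and "\<tau> > (0::real)"
    and sol: "\<forall>t\<in>{tn..tn+\<tau>}.
           (u has_vector_derivative T (u t) + (1/\<epsilon>) *\<^sub>R Q (u t)) (at t within {tn..tn+\<tau>})"
    and step: "\<forall>\<^sub>F dt in at_right 0. scheme_step T Q \<epsilon> s \<alpha> dt (u tn) (F dt) (ft dt) (fs dt) (fnew dt)"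
    and "\<forall>i\<in>{1..stages s}. (\<lambda>dt. norm (F dt i - u tn)) \<in> O[at_right 0](\<lambda>dt. dt)"
    and "(\<lambda>dt. norm (fs dt - u tn)) \<in> O[at_right 0](\<lambda>dt. dt)"
    and "(\<lambda>dt. norm (fnew dt - u tn)) \<in> O[at_right 0](\<lambda>dt. dt)"
  then have F1: "\<And>i. i \<in> {1..stages s} \<Longrightarrow> step_bigo 1 (\<lambda>d. F d i - u0)"
    and fs1: "step_bigo 1 (\<lambda>d. fs d - u0)" and fnew1: "step_bigo 1 (\<lambda>d. fnew d - u0)"
    by (simp_all add: step_bigo_iff_bigo u0_def)
  obtain LT KT where T: "\<forall>\<^sub>F x in nhds u0. norm (T x - T u0 - blinfun_apply LT (x - u0)) \<le> KT * norm (x - u0) ^ 2"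
    using C2_on_expansion[OF C2(1) U] unfolding u0_def by blast
  obtain LQ KQ where "KQ \<ge> 0"
    and Q: "\<forall>\<^sub>F x in nhds u0. norm (Q x - Q u0 - blinfun_apply LQ (x - u0)) \<le> KQ * norm (x - u0) ^ 2"
    and Q': "\<forall>\<^sub>F x in nhds u0. \<forall>v. norm (op_deriv Q x v - blinfun_apply LQ v) \<le> KQ * norm (x - u0) * norm v"
    using C2_on_expansion[OF C2(2) U] unfolding u0_def by blast

  define G where "G x = T x + e *\<^sub>R Q x" for x
  define L where "L = LT + e *\<^sub>R LQ"
  have Lx: "L x = LT x + e *\<^sub>R LQ x" for x
    by (simp add: L_def plus_blinfun.rep_eq scaleR_blinfun.rep_eq)
  have Gexp: "\<forall>\<^sub>F x in nhds u0. norm (G x - G u0 - L (x - u0)) \<le> (KT + \<bar>e\<bar> * KQ) * norm (x - u0) ^ 2"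
    using T Q
  proof eventually_elim
    case (elim x)
    have "G x - G u0 - L (x - u0) = (T x - T u0 - LT (x - u0)) + e *\<^sub>R (Q x - Q u0 - LQ (x - u0))"
      by (simp add: G_def Lx algebra_simps)
    also have "norm \<dots> \<le> norm (T x - T u0 - LT (x - u0)) + \<bar>e\<bar> * norm (Q x - Q u0 - LQ (x - u0))"
      by (metis norm_scaleR norm_triangle_ineq)
    also have "\<dots> \<le> KT * norm (x - u0) ^ 2 + \<bar>e\<bar> * (KQ * norm (x - u0) ^ 2)"
      using elim by (intro add_mono mult_left_mono) auto
    finally show ?case by (simp add: algebra_simps)
  qed
  have exact: "step_bigo 3 (\<lambda>d. u (tn + d) - u0 - d *\<^sub>R G u0 - (d^2 / 2) *\<^sub>R L (G u0))"
    unfolding u0_def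
    by (rule exact_solution_expansion[where u = u and tn = tn, OF Gexp[unfolded u0_def] \<open>\<tau> > 0\<close>])
       (use sol in \<open>simp add: G_def e_def\<close>)

  \<comment> \<open>the coefficient of \<open>d\<close> in the expansion of stage \<open>i\<close>\<close>
  define P where "P i = cE s i *\<^sub>R T u0 + cI s i *\<^sub>R (e *\<^sub>R Q u0)" for i
  have F2: "step_bigo 2 (\<lambda>d. F d i - u0 - d *\<^sub>R P i)" if i: "i \<in> {1..stages s}" for i
  proof -
    have "step_bigo 1 (\<lambda>d. (\<Sum>j\<in>{1..<i}. aE s i j *\<^sub>R (T (F d j) - T u0))
                    + (\<Sum>j\<in>{1..i}. aI s i j *\<^sub>R (e *\<^sub>R (Q (F d j) - Q u0))))"
      using i by (intro step_bigo_add step_bigo_sum step_bigo_scaleR step_bigo_lipschitz[OF T] step_bigo_lipschitz[OF Q] F1) auto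
    from step_bigo_step[OF this]
    have "step_bigo 2 (\<lambda>d. d *\<^sub>R ((\<Sum>j\<in>{1..<i}. aE s i j *\<^sub>R (T (F d j) - T u0))
                    + (\<Sum>j\<in>{1..i}. aI s i j *\<^sub>R (e *\<^sub>R (Q (F d j) - Q u0)))))"
      by (simp add: numeral_2_eq_2)
    then show ?thesis
    proof (rule step_bigo_cong)
      show "\<forall>\<^sub>F d in at_right 0. F d i - u0 - d *\<^sub>R P i =
          d *\<^sub>R ((\<Sum>j\<in>{1..<i}. aE s i j *\<^sub>R (T (F d j) - T u0))
                    + (\<Sum>j\<in>{1..i}. aI s i j *\<^sub>R (e *\<^sub>R (Q (F d j) - Q u0))))"
        using step
      proof eventually_elim
        case (elim d)
        then have "F d i = u0 + d *\<^sub>R (\<Sum>j\<in>{1..<i}. aE s i j *\<^sub>R T (F d j))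
             + d *\<^sub>R (\<Sum>j\<in>{1..i}. aI s i j *\<^sub>R (e *\<^sub>R Q (F d j)))"
          using i unfolding scheme_step_def u0_def e_def by blast
        then show ?case
          by (simp add: P_def cE_def cI_def scaleR_diff_right sum_subtractf scaleR_sum_left
              scaleR_sum_right sum_distrib_left sum_distrib_right scaleR_add_right mult_ac)
      qed
    qed
  qed

  let ?W = "{1..stages s}"
  \<comment> \<open>the coefficient of \<open>d\<^sup>2\<close> in the expansion of \<open>ft\<close>\<close>
  define M where "M = LT (\<Sum>i\<in>?W. wE s i *\<^sub>R P i) + e *\<^sub>R LQ (\<Sum>i\<in>?W. wI s i *\<^sub>R P i)"
  have ft3: "step_bigo 3 (\<lambda>d. ft d - u0 - d *\<^sub>R G u0 - d^2 *\<^sub>R M)"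
  proof -
    have "step_bigo 2 (\<lambda>d. (\<Sum>i\<in>?W. wE s i *\<^sub>R (T (F d i) - T u0 - d *\<^sub>R LT (P i)))
                  + (\<Sum>i\<in>?W. wI s i *\<^sub>R (e *\<^sub>R (Q (F d i) - Q u0 - d *\<^sub>R LQ (P i)))))"
      by (intro step_bigo_add step_bigo_sum step_bigo_scaleR step_bigo_linearize_first_order[OF T]
          step_bigo_linearize_first_order[OF Q] F1 F2)
    from step_bigo_step[OF this]
    have "step_bigo 3 (\<lambda>d. d *\<^sub>R ((\<Sum>i\<in>?W. wE s i *\<^sub>R (T (F d i) - T u0 - d *\<^sub>R LT (P i)))
                  + (\<Sum>i\<in>?W. wI s i *\<^sub>R (e *\<^sub>R (Q (F d i) - Q u0 - d *\<^sub>R LQ (P i))))))"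
      by (simp add: numeral_3_eq_3 numeral_2_eq_2)
    then show ?thesis
    proof (rule step_bigo_cong)
      have sums: "(\<Sum>i\<in>?W. wE s i) = 1" "(\<Sum>i\<in>?W. wI s i) = 1"
        using oc by (auto simp: order_conditions_def)
      show "\<forall>\<^sub>F d in at_right 0. ft d - u0 - d *\<^sub>R G u0 - d^2 *\<^sub>R M =
          d *\<^sub>R ((\<Sum>i\<in>?W. wE s i *\<^sub>R (T (F d i) - T u0 - d *\<^sub>R LT (P i)))
                  + (\<Sum>i\<in>?W. wI s i *\<^sub>R (e *\<^sub>R (Q (F d i) - Q u0 - d *\<^sub>R LQ (P i)))))"
        using step
      proof eventually_elim
        case (elim d)
        have wT: "(\<Sum>i\<in>?W. wE s i *\<^sub>R (T (F d i) - T u0 - d *\<^sub>R LT (P i)))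
            = (\<Sum>i\<in>?W. wE s i *\<^sub>R T (F d i)) - T u0 - d *\<^sub>R LT (\<Sum>i\<in>?W. wE s i *\<^sub>R P i)"
          using sums(1) by (simp add: scaleR_diff_right sum_subtractf blinfun.sum_right
              blinfun.scaleR_right scaleR_sum_right mult.commute flip: scaleR_sum_left)
        have wQ: "(\<Sum>i\<in>?W. wI s i *\<^sub>R (e *\<^sub>R (Q (F d i) - Q u0 - d *\<^sub>R LQ (P i))))
            = (\<Sum>i\<in>?W. wI s i *\<^sub>R (e *\<^sub>R Q (F d i))) - e *\<^sub>R Q u0
              - d *\<^sub>R (e *\<^sub>R LQ (\<Sum>i\<in>?W. wI s i *\<^sub>R P i))"
          using sums(2) by (simp add: scaleR_diff_right sum_subtractf blinfun.sum_right
              blinfun.scaleR_right scaleR_sum_right mult_ac flip: scaleR_sum_left sum_distrib_left)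
        have "ft d = u0 + d *\<^sub>R (\<Sum>i\<in>?W. wE s i *\<^sub>R T (F d i))
             + d *\<^sub>R (\<Sum>i\<in>?W. wI s i *\<^sub>R (e *\<^sub>R Q (F d i)))"
          using elim unfolding scheme_step_def u0_def e_def by blast
        then show ?case unfolding wT wQ G_def M_def
          by (simp add: algebra_simps power2_eq_square)
      qed
    qed
  qed

  \<comment> \<open>the last order condition, with its \<open>\<alpha>\<close>, is what leaves the excess over the exact solution\<close>
  have M: "M = (1/2) *\<^sub>R L (G u0) + (\<alpha> * e^2) *\<^sub>R LQ (Q u0)"
  proof -
    have sums: "(\<Sum>i\<in>?W. wE s i * cE s i) = 1/2" "(\<Sum>i\<in>?W. wE s i * cI s i) = 1/2"
      "(\<Sum>i\<in>?W. wI s i * cE s i) = 1/2" "(\<Sum>i\<in>?W. wI s i * cI s i) = 1/2 + \<alpha>"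
      using oc by (auto simp: order_conditions_def)
    have contract: "(\<Sum>i\<in>?W. w i *\<^sub>R P i) = (\<Sum>i\<in>?W. w i * cE s i) *\<^sub>R T u0
        + (\<Sum>i\<in>?W. w i * cI s i) *\<^sub>R (e *\<^sub>R Q u0)" for w
      unfolding P_def scaleR_sum_left by (simp add: scaleR_add_right sum.distrib mult.assoc)
    have "(\<Sum>i\<in>?W. wE s i *\<^sub>R P i) = (1/2) *\<^sub>R T u0 + (1/2) *\<^sub>R (e *\<^sub>R Q u0)"
      unfolding contract sums ..
    moreover have "(\<Sum>i\<in>?W. wI s i *\<^sub>R P i) = (1/2) *\<^sub>R T u0 + (1/2 + \<alpha>) *\<^sub>R (e *\<^sub>R Q u0)"
      unfolding contract sums ..
    ultimately show ?thesis unfolding M_def Lx G_def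
      by (simp add: blinfun.add_right blinfun.scaleR_right algebra_simps power2_eq_square)
  qed

  define R where "R d = op_deriv Q (fs d) (Q (fnew d))" for d
  \<comment> \<open>replacing \<open>fs\<close> and \<open>fnew\<close> by \<open>u0\<close> costs one order, which the factor \<open>d\<^sup>2\<close> can afford\<close>
  have R: "step_bigo 1 (\<lambda>d. R d - LQ (Q u0))"
  proof -
    have Qn: "step_bigo 1 (\<lambda>d. Q (fnew d) - Q u0)" by (rule step_bigo_lipschitz[OF Q fnew1])
    have "step_bigo 0 (\<lambda>d. (Q (fnew d) - Q u0) + Q u0)"
      by (rule step_bigo_add[OF step_bigo_mono[OF Qn] step_bigo_const]) simp
    then have "step_bigo 0 (\<lambda>d. norm (Q (fnew d)))" unfolding step_bigo_def by simp
    moreover have "step_bigo 1 (\<lambda>d. norm (fs d - u0))" using fs1 unfolding step_bigo_def by simp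
    ultimately have "step_bigo (1 + 0) (\<lambda>d. norm (fs d - u0) * norm (Q (fnew d)))"
      by (intro step_bigo_bounded_bilinear[OF bounded_bilinear_mult])
    from step_bigo_scaleR[OF this, of KQ]
    have "step_bigo 1 (\<lambda>d. KQ * norm (fs d - u0) * norm (Q (fnew d)))" by (simp add: mult_ac)
    then have "step_bigo 1 (\<lambda>d. R d - LQ (Q (fnew d)))"
    proof (rule step_bigo_dominated)
      have "(fs \<longlongrightarrow> u0) (at_right 0)"
        using step_bigo_tendsto_zero[OF fs1] by (simp add: LIM_zero_iff)
      then have "\<forall>\<^sub>F d in at_right 0. \<forall>v. norm (op_deriv Q (fs d) v - LQ v) \<le> KQ * norm (fs d - u0) * norm v"
        by (rule eventually_compose_filterlim[OF Q'])
      then show "\<forall>\<^sub>F d in at_right 0. norm (R d - LQ (Q (fnew d)))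
          \<le> norm (KQ * norm (fs d - u0) * norm (Q (fnew d)))"
        by eventually_elim (use \<open>KQ \<ge> 0\<close> in \<open>simp add: R_def\<close>)
    qed
    from step_bigo_add[OF this step_bigo_bounded_linear[OF blinfun.bounded_linear_right[of LQ] Qn]]
    show ?thesis by (simp add: blinfun.diff_right)
  qed
  have "step_bigo 3 (\<lambda>d. (\<alpha> * e^2) *\<^sub>R (d^2 *\<^sub>R (R d - LQ (Q u0))))"
    using step_bigo_scaleR[OF step_bigo_power_scaleR[OF R, of 2], of "\<alpha> * e^2"] by simp
  from step_bigo_diff[OF step_bigo_diff[OF ft3 this] exact]
  have "step_bigo 3 (\<lambda>d. fnew d - u (tn + d))"
  proof (rule step_bigo_cong)
    show "\<forall>\<^sub>F d in at_right 0. fnew d - u (tn + d) =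
        ft d - u0 - d *\<^sub>R G u0 - d^2 *\<^sub>R M - (\<alpha> * e^2) *\<^sub>R (d^2 *\<^sub>R (R d - LQ (Q u0)))
        - (u (tn + d) - u0 - d *\<^sub>R G u0 - (d^2 / 2) *\<^sub>R L (G u0))"
      using step
    proof eventually_elim
      case (elim d)
      then have "fnew d = ft d - (\<alpha> * d^2 * (1/\<epsilon>^2)) *\<^sub>R R d"
        unfolding scheme_step_def R_def by blast
      then have "fnew d = ft d - (\<alpha> * d^2 * e^2) *\<^sub>R R d"
        by (simp add: e_def power_one_over)
      then show ?case unfolding M by (simp add: algebra_simps)
    qed
  qed
  then show "(\<lambda>dt. norm (fnew dt - u (tn + dt))) \<in> O[at_right 0](\<lambda>dt. dt ^ 3)"
    by (simp add: step_bigo_iff_bigo)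
qed

section \<open>Accuracy and positivity of the corrected scheme\<close>

theorem mainTheorem1:
  fixes ev :: "'a::real_normed_vector \<Rightarrow> 'x \<Rightarrow> real"
    and T Q :: "'a \<Rightarrow> 'a"
    and C \<epsilon> \<alpha> :: real
    and s :: tableau
  assumes "function_space ev"
    and "op_differentiable Q"
    and "C > 0" and "P1 ev T C" and "P2 ev Q" and "P3 ev Q" and "P4 ev Q"
    and "\<epsilon> > 0" and "\<alpha> \<ge> 0"
    and "imex_tableau s" and "GSA s"
    and "type_A s \<and> positivity_A s \<or> type_ARS s \<and> positivity_ARS s"
    and "order_conditions s \<alpha>"
  shows "second_order_accurate T Q \<epsilon> s \<alpha> \<and>
    positivity_preserving ev T Q C \<epsilon> s \<alpha>"
proof
  show "second_order_accurate T Q \<epsilon> s \<alpha>"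
    by (rule second_order_accurate_if_order_conditions) fact
  \<comment> \<open>the weights have sum 1, so there is a stage\<close>
  have "stages s \<ge> 1"
    using \<open>order_conditions s \<alpha>\<close> by (cases "stages s = 0") (auto simp: order_conditions_def)
  then show "positivity_preserving ev T Q C \<epsilon> s \<alpha>"
    using assms by (intro positivity_preserving_if_positivity_conditions)
qed

end
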